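(* Let $(f_k)_{k\ge 1}$ be a sequence in $\mathcal L^1_E$ and let $f_0\in\mathcal L^1_E$. Then $(f_k)$ converges strongly to $f_0$ in $\mathcal L^1_E$ if and only if the following three conditions hold: (1) $(f_k)$ converges weakly to $f_0$ in $\mathcal L^1_E$; (2) $(f_k)$ satisfies the sequential Bocce criterion; (3) for each $B\in\mathcal F^+$, the set $\Delta_B:=\{m_B(f_k): k\in\mathbb N\}$ is relatively norm compact in $E$. Moreover, the equivalence remains valid if condition (1) is replaced by (1') $(f_k)$ converges to $f_0$ in the $\sigma(\mathcal L^1_E,\mathcal L^\infty_{E^*})$-topology, and/or if condition (3) is replaced by (3') $\lim_k\|m_B(f_k)-m_B(f_0)\|=0$ for each $B\in\mathcal F^+$.
   Context: $(E,\|\cdot\|)$ is a Banach space with dual $E^*$, and $(\Omega,\mathcal F,\mu)$ is a probability space. $\mathcal F^+$ is the collection of sets in $\mathcal F$ with strictly positive measure, and for $B\in\mathcal F$, $\mathcal F^+(B)$ is the collection of measurable subsets of $B$ with strictly positive measure. $\mathcal L^1_E$ is the (prequotient) space of Bochner $\mu$-integrable functions $f:\Omega\to E$, with seminorm $\|f\|_1=\int_\Omega\|f\|\,d\mu$; convergence in this seminorm is called strong convergence. Weak convergence means convergence against every continuous linear functional on $(\mathcal L^1_E,\|\cdot\|_1)$ (the dual being the space of bounded functions $b:\Omega\to E^*$ such that $\omega\mapsto\langle x,b(\omega)\rangle$ is measurable for each $x\in E$, acting by $f\mapsto\int_\Omega\langle f,b\rangle\,d\mu$). $\mathcal L^\infty_{E^*}$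 is the subspace of strongly measurable bounded functions $b:\Omega\to E^*$; $\sigma(\mathcal L^1_E,\mathcal L^\infty_{E^*})$ is the topology on $\mathcal L^1_E$ induced by the functionals $f\mapsto\int_\Omega\langle f,b\rangle\,d\mu$, $b\in\mathcal L^\infty_{E^*}$. For $f\in\mathcal L^1_E$ and $A\in\mathcal F$, put $m_A(f):=\frac{1}{\mu(A)}\int_A f\,d\mu$ and $\text{Bocce-osc } f|_A:=\frac{1}{\mu(A)}\int_A\|f-m_A(f)\|\,d\mu$ (with the convention $0/0=0$). A sequence $(f_k)$ in $\mathcal L^1_E$ satisfies the sequential Bocce criterion if for each subsequence $(f_{k_j})$, each $\epsilon>0$ and each $B\in\mathcal F^+$ there is $A\in\mathcal F^+(B)$ such that $\liminf_j \text{Bocce-osc } f_{k_j}|_A<\epsilon$. *)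

theory Defs
  imports "HOL-Probability.Probability"
begin

text \<open>
  The library's Bochner integral is restricted to second-countable (hence separable) range types.
  The definitions below follow the library's construction, but work in an arbitrary normed space:
  Borel measurability is replaced by strong measurability, because sums of Borel functions need
  not be Borel in a non-separable space. Strong measurability is meant everywhere on the space,
  not only almost everywhere.
\<close>

definition strongly_measurable :: "'w measure \<Rightarrow> ('w \<Rightarrow> 'a::real_normed_vector) \<Rightarrow> bool" where
  "strongly_measurable M f \<longleftrightarrow>
     (\<exists>s :: nat \<Rightarrow> 'w \<Rightarrow> 'a. (\<forall>i. simple_function M (s i)) \<and>
        (\<forall>w\<in>space M. (\<lambda>i. s i w) \<longlonglongrightarrow> f w))"

definition bochner_approx ::
    "'w measure \<Rightarrow> ('w \<Rightarrow> 'a::real_normed_vector) \<Rightarrow> (nat \<Rightarrow> 'w \<Rightarrow> 'a) \<Rightarrow> bool" where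
  "bochner_approx M f s \<longleftrightarrow>
     (\<forall>i. Bochner_Integration.simple_bochner_integrable M (s i)) \<and>
     (\<lambda>i. \<integral>\<^sup>+ w. ennreal (norm (f w - s i w)) \<partial>M) \<longlonglongrightarrow> 0"

definition L1 :: "'w measure \<Rightarrow> ('w \<Rightarrow> 'a::real_normed_vector) set" where
  "L1 M = {f. strongly_measurable M f \<and> (\<exists>s. bochner_approx M f s)}"

definition has_strong_integral ::
    "'w measure \<Rightarrow> ('w \<Rightarrow> 'a::real_normed_vector) \<Rightarrow> 'a \<Rightarrow> bool" where
  "has_strong_integral M f x \<longleftrightarrow>
     strongly_measurable M f \<and>
     (\<exists>s. bochner_approx M f s \<and>
        (\<lambda>i. Bochner_Integration.simple_bochner_integral M (s i)) \<longlonglongrightarrow> x)"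

definition strong_integral :: "'w measure \<Rightarrow> ('w \<Rightarrow> 'a::real_normed_vector) \<Rightarrow> 'a" where
  "strong_integral M f = (THE x. has_strong_integral M f x)"

lemma strongly_measurable_iff_borel_measurable:
  fixes f :: "'w \<Rightarrow> 'a::{real_normed_vector, second_countable_topology}"
  shows "strongly_measurable M f \<longleftrightarrow> f \<in> borel_measurable M"
proof
  assume "strongly_measurable M f"
  then obtain s where s: "\<And>i. simple_function M (s i)"
      and lim: "\<And>w. w \<in> space M \<Longrightarrow> (\<lambda>i. s i w) \<longlonglongrightarrow> f w"
    unfolding strongly_measurable_def by blast
  show "f \<in> borel_measurable M"
    by (rule borel_measurable_LIMSEQ_metric[OF borel_measurable_simple_function[OF s] lim])
next
  assume "f \<in> borel_measurable M"
  from borel_measurable_implies_sequence_metric[OF this, of 0]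
  show "strongly_measurable M f"
    unfolding strongly_measurable_def by blast
qed

lemma has_strong_integral_iff_has_bochner_integral:
  fixes f :: "'w \<Rightarrow> 'a::{real_normed_vector, second_countable_topology}"
  shows "has_strong_integral M f x \<longleftrightarrow> has_bochner_integral M f x"
  unfolding has_strong_integral_def bochner_approx_def has_bochner_integral.simps
    strongly_measurable_iff_borel_measurable
  by auto

definition L1_norm :: "'w measure \<Rightarrow> ('w \<Rightarrow> 'a::real_normed_vector) \<Rightarrow> real" where
  "L1_norm M f = (\<integral>w. norm (f w) \<partial>M)"

definition strongly_convergent ::
    "'w measure \<Rightarrow> (nat \<Rightarrow> 'w \<Rightarrow> 'a::real_normed_vector) \<Rightarrow> ('w \<Rightarrow> 'a) \<Rightarrow> bool" where
  "strongly_convergent M f f0 \<longleftrightarrow> (\<lambda>k. L1_norm M (\<lambda>w. f k w - f0 w)) \<longlonglongrightarrow> 0"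

definition L1_dual :: "'w measure \<Rightarrow> (('w \<Rightarrow> 'a::real_normed_vector) \<Rightarrow> real) set" where
  "L1_dual M = {\<phi>.
     (\<forall>f\<in>L1 M. \<forall>g\<in>L1 M. \<phi> (\<lambda>w. f w + g w) = \<phi> f + \<phi> g) \<and>
     (\<forall>c. \<forall>f\<in>L1 M. \<phi> (\<lambda>w. c *\<^sub>R f w) = c * \<phi> f) \<and>
     (\<forall>f\<in>L1 M. \<forall>\<epsilon>>0. \<exists>\<delta>>0. \<forall>g\<in>L1 M.
        L1_norm M (\<lambda>w. g w - f w) < \<delta> \<longrightarrow> \<bar>\<phi> g - \<phi> f\<bar> < \<epsilon>)}"

definition weakly_convergent ::
    "'w measure \<Rightarrow> (nat \<Rightarrow> 'w \<Rightarrow> 'a::real_normed_vector) \<Rightarrow> ('w \<Rightarrow> 'a) \<Rightarrow> bool" where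
  "weakly_convergent M f f0 \<longleftrightarrow> (\<forall>\<phi>\<in>L1_dual M. (\<lambda>k. \<phi> (f k)) \<longlonglongrightarrow> \<phi> f0)"

definition Linf_dual :: "'w measure \<Rightarrow> ('w \<Rightarrow> ('a::real_normed_vector \<Rightarrow>\<^sub>L real)) set" where
  "Linf_dual M = {b. strongly_measurable M b \<and> bounded (b ` space M)}"

text \<open>The coarsest topology on \<open>L1 M\<close> making all \<open>f \<mapsto> \<integral>\<langle>f, b\<rangle>\<close> with \<open>b \<in> Linf_dual M\<close> continuous.\<close>

definition sigma_topology :: "'w measure \<Rightarrow> ('w \<Rightarrow> 'a::real_normed_vector) topology" where
  "sigma_topology M = topology_generated_by
     {{f \<in> L1 M. (\<integral>w. blinfun_apply (b w) (f w) \<partial>M) \<in> U} | b U. b \<in> Linf_dual M \<and> open U}"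

definition pos_sets :: "'w measure \<Rightarrow> 'w set set" where
  "pos_sets M = {A \<in> sets M. measure M A > 0}"

definition pos_subsets :: "'w measure \<Rightarrow> 'w set \<Rightarrow> 'w set set" where
  "pos_subsets M B = {A \<in> pos_sets M. A \<subseteq> B}"

definition mean_on :: "'w measure \<Rightarrow> 'w set \<Rightarrow> ('w \<Rightarrow> 'a::real_normed_vector) \<Rightarrow> 'a" where
  "mean_on M A f = (1 / measure M A) *\<^sub>R strong_integral M (\<lambda>w. indicator A w *\<^sub>R f w)"

definition bocce_osc :: "'w measure \<Rightarrow> 'w set \<Rightarrow> ('w \<Rightarrow> 'a::real_normed_vector) \<Rightarrow> real" where
  "bocce_osc M A f =
     (1 / measure M A) * set_lebesgue_integral M A (\<lambda>w. norm (f w - mean_on M A f))"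

definition seq_bocce_criterion ::
    "'w measure \<Rightarrow> (nat \<Rightarrow> 'w \<Rightarrow> 'a::real_normed_vector) \<Rightarrow> bool" where
  "seq_bocce_criterion M f \<longleftrightarrow>
     (\<forall>r :: nat \<Rightarrow> nat. strict_mono r \<longrightarrow>
       (\<forall>\<epsilon>>0. \<forall>B\<in>pos_sets M. \<exists>A\<in>pos_subsets M B.
          liminf (\<lambda>j. ereal (bocce_osc M A (f (r j)))) < ereal \<epsilon>))"

definition means_relatively_compact ::
    "'w measure \<Rightarrow> (nat \<Rightarrow> 'w \<Rightarrow> 'a::real_normed_vector) \<Rightarrow> bool" where
  "means_relatively_compact M f \<longleftrightarrow>
     (\<forall>B\<in>pos_sets M. compact (closure (range (\<lambda>k. mean_on M B (f k)))))"

definition means_convergent ::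
    "'w measure \<Rightarrow> (nat \<Rightarrow> 'w \<Rightarrow> 'a::real_normed_vector) \<Rightarrow> ('w \<Rightarrow> 'a) \<Rightarrow> bool" where
  "means_convergent M f f0 \<longleftrightarrow>
     (\<forall>B\<in>pos_sets M. (\<lambda>k. norm (mean_on M B (f k) - mean_on M B f0)) \<longlonglongrightarrow> 0)"

end

theory Submission
  imports Defs
begin

text \<open>
  Only the sufficiency of the weakest conditions (1'), (2), (3') needs work. Testing against all
  \<open>b \<in> \<L>\<^sup>\<infinity>\<close> forces the norms of \<open>f\<^sub>k - f\<^sub>0\<close> to be uniformly integrable up to finitely many \<open>k\<close>
  (gliding hump). The function \<open>f\<^sub>0\<close> is nearly constant on a subset of every set of positive
  measure, so the Bocce criterion together with the convergence of the means yields, inside every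
  such set, a set \<open>A\<close> of positive measure on which the average of \<open>\<parallel>f\<^sub>k - f\<^sub>0\<parallel>\<close> is small for
  infinitely many \<open>k\<close>. This property passes to disjoint unions after thinning out the indices;
  exhausting \<open>\<Omega>\<close> by such sets leaves a remainder that uniform integrability controls.
\<close>

section \<open>The Hahn--Banach theorem\<close>

text \<open>Since E may be non-separable, statements about E-valued integrals are reduced to real
  integrals by continuous functionals. Hahn-Banach therefore has three uses: uniqueness of the value
  behind \<open>strong_integral\<close>, norm bounds for differences of means, and the norming
  multipliers of the gliding hump. The obstacle in the exhaustion is that the Bocce criterion bounds
  only a liminf: the good indices depend on the set A, so each enlargement of the exhausting set
  forces a passage to a smaller infinite index set, and countably many such passages may leave no
  common index. A set almost contained in all of them repairs this. Infinitely many good indices are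
  enough because the argument by contradiction runs inside the set of k for which the norm of
  \<open>f k - f0\<close> stays large. Test functions have to be strongly measurable at every point.
  This is why the gliding hump works with simple multipliers, each point being either changed only
  finitely often or put into an exceptional set where the limit is declared to be 0.\<close>

definition sublinear :: "('a::real_vector \<Rightarrow> real) \<Rightarrow> bool" where
  "sublinear p \<longleftrightarrow> (\<forall>x y. p (x + y) \<le> p x + p y) \<and> (\<forall>c>0. \<forall>x. p (c *\<^sub>R x) \<le> c * p x)"

lemma sublinear_add: "sublinear p \<Longrightarrow> p (x + y) \<le> p x + p y"
  by (simp add: sublinear_def)

text \<open>The definition asks only for the inequality that infima inherit easily; applying it with
  \<open>inverse c\<close> gives the reverse one.\<close>

lemma sublinear_scaleR:
  assumes "sublinear p" "c > 0"
  shows "p (c *\<^sub>R x) = c * p x"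
proof -
  have "p (inverse c *\<^sub>R (c *\<^sub>R x)) \<le> inverse c * p (c *\<^sub>R x)"
    using assms by (simp add: sublinear_def del: scaleR_scaleR)
  then have "c * p x \<le> p (c *\<^sub>R x)"
    using assms by (simp add: field_simps)
  with assms show ?thesis by (simp add: sublinear_def antisym)
qed

lemma sublinear_zero: "sublinear p \<Longrightarrow> p 0 = 0"
  using sublinear_scaleR[of p 2 0] by simp

lemma sublinear_ge_minus: "sublinear p \<Longrightarrow> - p (- x) \<le> p x"
  using sublinear_add[of p x "- x"] sublinear_zero[of p] by simp

text \<open>The chain step for Zorn's lemma. The infima are finite because \<open>- n (- x)\<close>
  is a lower bound for every member at \<open>x\<close>. Subadditivity uses comparability: of two
  members evaluated at \<open>x\<close> and at \<open>y\<close>, the smaller one serves both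
  points.\<close>

lemma sublinear_Inf_chain:
  assumes C: "\<And>p. p \<in> C \<Longrightarrow> sublinear p \<and> p \<le> n"
    and total: "\<And>p q. p \<in> C \<Longrightarrow> q \<in> C \<Longrightarrow> p \<le> q \<or> q \<le> p"
    and ne: "C \<noteq> {}"
  defines "q \<equiv> \<lambda>x. INF p\<in>C. p x"
  shows "sublinear q" and "\<And>p. p \<in> C \<Longrightarrow> q \<le> p"
proof -
  have q: "q x = (INF p\<in>C. p x)" for x by (simp add: q_def)
  have bdd: "bdd_below ((\<lambda>p. p x) ` C)" for x
  proof (rule bdd_belowI2)
    fix p assume "p \<in> C"
    then show "- n (- x) \<le> p x"
      using sublinear_ge_minus[of p x] C[of p] le_funD[of p n "- x"] by linarith
  qed
  have le: "q x \<le> p x" if "p \<in> C" for p x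
    unfolding q using that by (intro cINF_lower bdd)
  show "q \<le> p" if "p \<in> C" for p
    using le[OF that] by (simp add: le_fun_def)
  have "q (x + y) \<le> q x + q y" for x y
  proof -
    have pair: "q (x + y) \<le> p x + p' y" if pp: "p \<in> C" "p' \<in> C" for p p'
    proof -
      obtain m where m: "m \<in> C" "m \<le> p" "m \<le> p'"
        using total[OF pp] pp by blast
      have "q (x + y) \<le> m x + m y"
        using le[OF m(1)] sublinear_add[of m x y] C[OF m(1)] by (meson order_trans)
      with le_funD[OF m(2), of x] le_funD[OF m(3), of y] show ?thesis by linarith
    qed
    have "q (x + y) - p x \<le> q y" if "p \<in> C" for p
      unfolding q[of y] using pair[OF that] ne
      by (intro cINF_greatest) (auto simp: algebra_simps)
    then have "q (x + y) - q y \<le> q x"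
      unfolding q[of x] using ne by (intro cINF_greatest) (auto simp: algebra_simps)
    then show ?thesis by simp
  qed
  moreover have "q (c *\<^sub>R x) \<le> c * q x" if "c > 0" for c x
  proof -
    have "q (c *\<^sub>R x) / c \<le> q x"
      unfolding q[of x]
    proof (rule cINF_greatest[OF ne])
      fix p assume p: "p \<in> C"
      then show "q (c *\<^sub>R x) / c \<le> p x"
        using le[OF p, of "c *\<^sub>R x"] sublinear_scaleR[of p c x] C[OF p] \<open>c > 0\<close>
        by (simp add: field_simps)
    qed
    then show ?thesis using \<open>c > 0\<close> by (simp add: field_simps)
  qed
  ultimately show "sublinear q" by (simp add: sublinear_def)
qed

lemma minimal_sublinear_exists:
  assumes "sublinear n"
  obtains p where "sublinear p" "p \<le> n" "\<And>q. sublinear q \<Longrightarrow> q \<le> p \<Longrightarrow> q = p"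
proof -
  define P where "P = {p. sublinear p \<and> p \<le> n}"
  have "\<exists>m\<in>P. \<forall>a\<in>P. a \<le> m \<longrightarrow> a = m"
  \<comment> \<open>The order is reversed, so the maximal element found is minimal and upper bounds
    of chains are their infima.\<close>
  proof (rule predicate_Zorn[where P = "\<lambda>p q. q \<le> p"])
    show "partial_order_on P (relation_of (\<lambda>p q. q \<le> p) P)"
      by (rule partial_order_on_relation_ofI) auto
    fix C assume "C \<in> Chains (relation_of (\<lambda>p q. q \<le> p) P)"
    then have CP: "C \<subseteq> P" and tot: "\<And>p q. p \<in> C \<Longrightarrow> q \<in> C \<Longrightarrow> p \<le> q \<or> q \<le> p"
      unfolding Chains_def relation_of_def by blast+
    show "\<exists>u\<in>P. \<forall>a\<in>C. u \<le> a"
    proof (cases "C = {}")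
      case True
      then show ?thesis using assms by (auto simp: P_def)
    next
      case False
      have C: "\<And>p. p \<in> C \<Longrightarrow> sublinear p \<and> p \<le> n" using CP by (auto simp: P_def)
      note q = sublinear_Inf_chain[OF C tot False, simplified]
      from False obtain p where "p \<in> C" by blast
      then have "(\<lambda>x. INF p\<in>C. p x) \<le> n" using q(2) C by (meson order_trans)
      with q show ?thesis by (auto simp: P_def)
    qed
  qed
  then obtain m where m: "m \<in> P" "\<And>a. a \<in> P \<Longrightarrow> a \<le> m \<Longrightarrow> a = m" by blast
  show thesis
  proof (rule that[of m])
    fix q assume "sublinear q" "q \<le> m"
    then show "q = m" using m by (auto simp: P_def intro: order_trans)
  qed (use m in \<open>auto simp: P_def\<close>)
qed

text \<open>In the infimum over t of \<open>p (z + t *\<^sub>R y) - t * p y\<close>, t = 0 gives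
  \<open>q \<le> p\<close> and t = 1 at \<open>- y\<close> gives the last claim. A linear functional
  below \<open>q\<close> is thus forced to be at least \<open>p y\<close> at \<open>y\<close>. The
  infimum is finite since \<open>p (t *\<^sub>R y) = t * p y\<close> for nonnegative t.\<close>

lemma sublinear_below:
  assumes p: "sublinear p"
  obtains q where "sublinear q" "q \<le> p" "q (- y) \<le> - p y"
proof -
  define T where "T = {0::real..}"
  define q where "q z = (INF t\<in>T. p (z + t *\<^sub>R y) - t * p y)" for z
  have ne: "T \<noteq> {}" by (auto simp: T_def)
  have sc: "p (t *\<^sub>R y) = t * p y" if "t \<ge> 0" for t
    using sublinear_scaleR[OF p, of t y] sublinear_zero[OF p] that by (cases "t = 0") auto
  have bdd: "bdd_below ((\<lambda>t. p (z + t *\<^sub>R y) - t * p y) ` T)" for z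
  proof (rule bdd_belowI2)
    fix t assume "t \<in> T"
    then show "- p (- z) \<le> p (z + t *\<^sub>R y) - t * p y"
      using sublinear_add[OF p, of "z + t *\<^sub>R y" "- z"] sc[of t] by (simp add: T_def)
  qed
  have le: "q z \<le> p (z + t *\<^sub>R y) - t * p y" if "t \<ge> 0" for z t
    unfolding q_def using that by (intro cINF_lower bdd) (auto simp: T_def)
  have "q (x + z) \<le> q x + q z" for x z
  proof -
    have pair: "q (x + z) \<le> (p (x + s *\<^sub>R y) - s * p y) + (p (z + t *\<^sub>R y) - t * p y)"
      if "s \<in> T" "t \<in> T" for s t
      using le[of "s + t" "x + z"] sublinear_add[OF p, of "x + s *\<^sub>R y" "z + t *\<^sub>R y"] that
      by (simp add: T_def algebra_simps)
    have "q (x + z) - (p (x + s *\<^sub>R y) - s * p y) \<le> q z" if "s \<in> T" for s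
      unfolding q_def[of z] using pair[OF that] ne
      by (intro cINF_greatest) (auto simp: algebra_simps)
    then have "q (x + z) - q z \<le> q x"
      unfolding q_def[of x] using ne by (intro cINF_greatest) (auto simp: algebra_simps)
    then show ?thesis by simp
  qed
  moreover have "q (c *\<^sub>R x) \<le> c * q x" if "c > 0" for c x
  proof -
    have "q (c *\<^sub>R x) / c \<le> q x"
      unfolding q_def[of x]
    proof (rule cINF_greatest[OF ne])
      fix t assume t: "t \<in> T"
      have "p (c *\<^sub>R x + (c * t) *\<^sub>R y) = c * p (x + t *\<^sub>R y)"
        using sublinear_scaleR[OF p \<open>c > 0\<close>, of "x + t *\<^sub>R y"] by (simp add: algebra_simps)
      then show "q (c *\<^sub>R x) / c \<le> p (x + t *\<^sub>R y) - t * p y"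
        using le[of "c * t" "c *\<^sub>R x"] t \<open>c > 0\<close> by (simp add: T_def field_simps)
    qed
    then show ?thesis using \<open>c > 0\<close> by (simp add: field_simps)
  qed
  ultimately have "sublinear q" by (simp add: sublinear_def)
  moreover have "q \<le> p" using le[of 0] by (auto simp: le_fun_def)
  moreover have "q (- y) \<le> - p y" using le[of 1 "- y"] sublinear_zero[OF p] by simp
  ultimately show thesis by (rule that)
qed

text \<open>Minimality identifies \<open>p\<close> with the functional that
  \<open>sublinear_below\<close> produces for \<open>y\<close>, so
  \<open>p (- y) \<le> - p y\<close>. Hence \<open>p\<close> is odd, and an odd subadditive function
  is additive.\<close>

lemma minimal_sublinear_linear:
  assumes p: "sublinear p" and min: "\<And>q. sublinear q \<Longrightarrow> q \<le> p \<Longrightarrow> q = p"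
  shows "linear p"
proof -
  have odd: "p (- y) = - p y" for y
  proof -
    obtain q where "sublinear q" "q \<le> p" "q (- y) \<le> - p y"
      by (rule sublinear_below[OF p, of y])
    then show ?thesis using min sublinear_ge_minus[OF p, of "- y"] by force
  qed
  have "p (x + y) = p x + p y" for x y
    using sublinear_add[OF p, of x y] sublinear_add[OF p, of "- x" "- y"] odd[of "x + y"]
      odd[of x] odd[of y] by simp
  moreover have "p (c *\<^sub>R x) = c *\<^sub>R p x" for c x
  proof (cases c "0::real" rule: linorder_cases)
    case less
    then show ?thesis using sublinear_scaleR[OF p, of "- c" x] odd[of "c *\<^sub>R x"] by simp
  qed (use sublinear_scaleR[OF p, of c x] sublinear_zero[OF p] in auto)
  ultimately show ?thesis by (rule linearI)
qed

text \<open>Hahn--Banach: a sublinear functional that is minimal below the norm is linear, and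
  starting the descent from \<open>z \<mapsto> inf\<^bsub>t\<ge>0\<^esub> (\<parallel>z + tx\<parallel> - t\<parallel>x\<parallel>)\<close> makes it norm \<open>x\<close>.\<close>

lemma norming_functional_exists:
  fixes x :: "'a::real_normed_vector"
  obtains \<phi> :: "'a \<Rightarrow>\<^sub>L real" where "norm \<phi> \<le> 1" "blinfun_apply \<phi> x = norm x"
proof -
  have "sublinear (norm :: 'a \<Rightarrow> real)" by (simp add: sublinear_def norm_triangle_ineq)
  then obtain q :: "'a \<Rightarrow> real" where q: "sublinear q" "q \<le> norm" "q (- x) \<le> - norm x"
    using sublinear_below by blast
  obtain p where p: "sublinear p" "p \<le> q" "\<And>r. sublinear r \<Longrightarrow> r \<le> p \<Longrightarrow> r = p"
    using minimal_sublinear_exists[OF q(1)] by blast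
  interpret p: linear p by (rule minimal_sublinear_linear[OF p(1,3)])
  have le: "p y \<le> norm y" for y using p(2) q(2) by (meson le_funD order_trans)
  have bnd: "\<bar>p y\<bar> \<le> norm y" for y using le[of y] le[of "- y"] by (simp add: p.neg)
  have bl: "bounded_linear p"
    by (rule bounded_linear_intro[where K = 1])
      (use bnd in \<open>auto simp: p.add p.scale\<close>)
  have "norm x \<le> p x" using p(2) q(3) le_funD[of p q "- x"] by (simp add: p.neg)
  with le[of x] have "p x = norm x" by simp
  moreover have "norm (Blinfun p) \<le> 1"
    by (rule norm_blinfun_bound) (use bnd bl in \<open>auto simp: bounded_linear_Blinfun_apply\<close>)
  ultimately show thesis
    using that[of "Blinfun p"] bl by (simp add: bounded_linear_Blinfun_apply)
qed

text \<open>Lets identities between E-valued integrals be checked after applying functionals, where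
  the ordinary Lebesgue integral is available.\<close>

lemma blinfun_separate:
  fixes x y :: "'a::real_normed_vector"
  assumes "\<And>\<phi> :: 'a \<Rightarrow>\<^sub>L real. blinfun_apply \<phi> x = blinfun_apply \<phi> y"
  shows "x = y"
proof -
  obtain \<phi> :: "'a \<Rightarrow>\<^sub>L real" where "blinfun_apply \<phi> (x - y) = norm (x - y)"
    using norming_functional_exists[of "x - y"] by blast
  then show ?thesis using assms[of \<phi>] by (simp add: blinfun.diff_right)
qed

section \<open>Bochner integrable functions\<close>

lemma strongly_measurableI:
  assumes "\<And>i. simple_function M (s i)" "\<And>w. w \<in> space M \<Longrightarrow> (\<lambda>i. s i w) \<longlonglongrightarrow> f w"
  shows "strongly_measurable M f"
  unfolding strongly_measurable_def using assms by blast

lemma strongly_measurable_simple: "simple_function M f \<Longrightarrow> strongly_measurable M f"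
  by (rule strongly_measurableI[where s = "\<lambda>_. f"]) auto

text \<open>Simple functions are closed under every binary operation, so the approximants can be
  combined index by index; continuity is used only at the limit points.\<close>

lemma strongly_measurable_compose2:
  assumes "strongly_measurable M f" "strongly_measurable M g"
    and "\<And>w. w \<in> space M \<Longrightarrow> isCont (\<lambda>x. h (fst x) (snd x)) (f w, g w)"
  shows "strongly_measurable M (\<lambda>w. h (f w) (g w))"
proof -
  obtain s where s: "\<And>i. simple_function M (s i)" "\<And>w. w \<in> space M \<Longrightarrow> (\<lambda>i. s i w) \<longlonglongrightarrow> f w"
    using assms(1) by (auto simp: strongly_measurable_def)
  obtain t where t: "\<And>i. simple_function M (t i)" "\<And>w. w \<in> space M \<Longrightarrow> (\<lambda>i. t i w) \<longlonglongrightarrow> g w"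
    using assms(2) by (auto simp: strongly_measurable_def)
  show ?thesis
  proof (rule strongly_measurableI)
    show "simple_function M (\<lambda>w. h (s i w) (t i w))" for i
      by (rule simple_function_compose2[OF s(1) t(1)])
    show "(\<lambda>i. h (s i w) (t i w)) \<longlonglongrightarrow> h (f w) (g w)" if "w \<in> space M" for w
      using isCont_tendsto_compose[OF assms(3)[OF that] tendsto_Pair[OF s(2) t(2)], OF that that]
      by simp
  qed
qed

lemma strongly_measurable_const: "strongly_measurable M (\<lambda>_. x)"
  by (intro strongly_measurable_simple simple_function_const)

lemma strongly_measurable_diff:
  "strongly_measurable M f \<Longrightarrow> strongly_measurable M g \<Longrightarrow> strongly_measurable M (\<lambda>w. f w - g w)"
  by (rule strongly_measurable_compose2) (auto intro!: continuous_intros)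

lemma borel_measurable_pairing:
  fixes b :: "'w \<Rightarrow> ('a::real_normed_vector \<Rightarrow>\<^sub>L real)"
  assumes "strongly_measurable M b" "strongly_measurable M f"
  shows "(\<lambda>w. blinfun_apply (b w) (f w)) \<in> borel_measurable M"
  unfolding strongly_measurable_iff_borel_measurable[symmetric]
  using assms by (rule strongly_measurable_compose2) (auto intro!: continuous_intros)

lemma borel_measurable_norm_strong:
  assumes "strongly_measurable M f"
  shows "(\<lambda>w. norm (f w)) \<in> borel_measurable M"
  unfolding strongly_measurable_iff_borel_measurable[symmetric]
  using strongly_measurable_compose2[OF assms assms, of "\<lambda>x y. norm x"]
  by (auto intro!: continuous_intros)

lemma strongly_measurable_indicator:
  assumes "A \<in> sets M" "strongly_measurable M f"
  shows "strongly_measurable M (\<lambda>w. indicator A w *\<^sub>R f w)"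
proof -
  have "strongly_measurable M (indicator A :: _ \<Rightarrow> real)"
    using assms by (simp add: strongly_measurable_iff_borel_measurable)
  from this assms(2) show ?thesis
    by (rule strongly_measurable_compose2) (auto intro!: continuous_intros)
qed

context finite_measure
begin

lemma simple_bochner_integrable_iff:
  "Bochner_Integration.simple_bochner_integrable M s \<longleftrightarrow> simple_function M s"
  by (simp add: simple_bochner_integrable.simps)

lemma integrable_norm_simple: "simple_function M s \<Longrightarrow> integrable M (\<lambda>w. norm (s w))"
  by (intro integrableI_simple_bochner_integrable)
    (simp add: simple_bochner_integrable_iff simple_function_compose1)

lemma integrable_norm_if_L1:
  assumes "f \<in> L1 M"
  shows "integrable M (\<lambda>w. norm (f w))"
proof -
  obtain s where sm: "strongly_measurable M f" and s: "bochner_approx M f s"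
    using assms by (auto simp: L1_def)
  then have lim: "(\<lambda>i. \<integral>\<^sup>+ w. ennreal (norm (f w - s i w)) \<partial>M) \<longlonglongrightarrow> 0"
    and si: "\<And>i. simple_function M (s i)"
    by (auto simp: bochner_approx_def simple_bochner_integrable_iff)
  from order_tendstoD(2)[OF lim, of 1]
  obtain i where i: "(\<integral>\<^sup>+ w. ennreal (norm (f w - s i w)) \<partial>M) < 1"
    by (auto simp: eventually_sequentially)
  note [measurable] = borel_measurable_norm_strong[OF sm]
    borel_measurable_norm_strong[OF strongly_measurable_diff[OF sm strongly_measurable_simple[OF si]]]
    borel_measurable_norm_strong[OF strongly_measurable_simple[OF si]]
  have "(\<integral>\<^sup>+ w. ennreal (norm (f w)) \<partial>M)
      \<le> (\<integral>\<^sup>+ w. ennreal (norm (f w - s i w)) + ennreal (norm (s i w)) \<partial>M)"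
    by (intro nn_integral_mono)
      (simp flip: ennreal_plus add: norm_triangle_sub add.commute)
  also have "\<dots> = (\<integral>\<^sup>+ w. ennreal (norm (f w - s i w)) \<partial>M) + (\<integral>\<^sup>+ w. ennreal (norm (s i w)) \<partial>M)"
    by (intro nn_integral_add) measurable
  also have "\<dots> < \<infinity>"
    using i integrable_norm_simple[OF si[of i]]
    by (auto simp: integrable_iff_bounded intro: less_trans)
  finally show ?thesis
    by (intro integrableI_bounded) (auto intro: borel_measurable_norm_strong[OF sm])
qed

text \<open>Truncating the simple approximants at \<open>2\<parallel>f\<parallel>\<close> makes them dominated by \<open>f\<close>.\<close>

lemma bochner_approx_exists:
  assumes sm: "strongly_measurable M f" and int: "integrable M (\<lambda>w. norm (f w))"
  obtains s where "bochner_approx M f s"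
proof -
  obtain s where s: "\<And>i. simple_function M (s i)" "\<And>w. w \<in> space M \<Longrightarrow> (\<lambda>i. s i w) \<longlonglongrightarrow> f w"
    using sm by (auto simp: strongly_measurable_def)
  note [measurable] = borel_measurable_norm_strong[OF sm]
    borel_measurable_norm_strong[OF strongly_measurable_simple[OF s(1)]]
  define t where "t i w = (if norm (s i w) \<le> 2 * norm (f w) then s i w else 0)" for i w
  have t: "simple_function M (t i)" for i
    unfolding t_def by (intro simple_function_If s simple_function_const) measurable
  \<comment> \<open>Because 2 > 1, the truncation is eventually inactive where \<open>f w\<close> is
    nonzero; where \<open>f w = 0\<close> it forces the value 0.\<close>
  have lim: "(\<lambda>i. t i w) \<longlonglongrightarrow> f w" if w: "w \<in> space M" for w
  proof (cases "f w = 0")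
    case True
    then have "t i w = 0" for i by (simp add: t_def)
    with True show ?thesis by simp
  next
    case False
    then have "norm (f w) < 2 * norm (f w)" by simp
    from order_tendstoD(2)[OF tendsto_norm[OF s(2)[OF w]] this]
    have "\<forall>\<^sub>F i in sequentially. t i w = s i w"
      by eventually_elim (simp add: t_def)
    with s(2)[OF w] show ?thesis by (simp add: tendsto_cong)
  qed
  note dm = borel_measurable_norm_strong[OF strongly_measurable_diff[OF sm strongly_measurable_simple[OF t]]]
  have dom: "norm (f w - t i w) \<le> 3 * norm (f w)" for i w
    using norm_triangle_ineq4[of "f w" "t i w"] by (auto simp: t_def split: if_splits)
  have "(\<lambda>i. \<integral>w. norm (f w - t i w) \<partial>M) \<longlonglongrightarrow> (\<integral>w. 0 \<partial>M)"
  proof (rule integral_dominated_convergence[where w = "\<lambda>w. 3 * norm (f w)"])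
    show "AE w in M. (\<lambda>i. norm (f w - t i w)) \<longlonglongrightarrow> 0"
      using lim by (auto intro!: AE_I2 tendsto_eq_intros)
  qed (use dm int dom in auto)
  moreover have "(\<integral>\<^sup>+ w. ennreal (norm (f w - t i w)) \<partial>M) = ennreal (\<integral>w. norm (f w - t i w) \<partial>M)" for i
    by (intro nn_integral_eq_integral Bochner_Integration.integrable_bound[OF integrable_mult_right[OF int, of 3]])
      (use dm dom in auto)
  ultimately have "bochner_approx M f t"
    using t by (simp add: bochner_approx_def simple_bochner_integrable_iff ennreal_tendsto_0_iff)
  then show thesis by (rule that)
qed

text \<open>Bochner's criterion. From here on, membership in \<open>L1 M\<close> is strong
  measurability together with the integrability of one real function.\<close>

lemma L1_iff: "f \<in> L1 M \<longleftrightarrow> strongly_measurable M f \<and> integrable M (\<lambda>w. norm (f w))"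
proof
  show "f \<in> L1 M \<Longrightarrow> strongly_measurable M f \<and> integrable M (\<lambda>w. norm (f w))"
    using integrable_norm_if_L1 by (simp add: L1_def)
  show "strongly_measurable M f \<and> integrable M (\<lambda>w. norm (f w)) \<Longrightarrow> f \<in> L1 M"
    using bochner_approx_exists[of f] unfolding L1_def by blast
qed

lemma L1_const: "(\<lambda>_. x) \<in> L1 M"
  by (simp add: L1_iff strongly_measurable_const)

lemma L1_simple: "simple_function M s \<Longrightarrow> s \<in> L1 M"
  by (simp add: L1_iff strongly_measurable_simple integrable_norm_simple)

lemma L1_diff:
  assumes "f \<in> L1 M" "g \<in> L1 M"
  shows "(\<lambda>w. f w - g w) \<in> L1 M"
proof -
  have sm: "strongly_measurable M (\<lambda>w. f w - g w)"
    using assms by (simp add: L1_iff strongly_measurable_diff)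
  moreover have "integrable M (\<lambda>w. norm (f w) + norm (g w))"
    using assms by (simp add: L1_iff)
  then have "integrable M (\<lambda>w. norm (f w - g w))"
    by (rule Bochner_Integration.integrable_bound)
      (auto simp: norm_triangle_ineq4 borel_measurable_norm_strong[OF sm])
  ultimately show ?thesis by (simp add: L1_iff)
qed

lemma L1_indicator:
  assumes "A \<in> sets M" "f \<in> L1 M"
  shows "(\<lambda>w. indicator A w *\<^sub>R f w) \<in> L1 M"
proof -
  have "integrable M (\<lambda>w. indicator A w *\<^sub>R norm (f w))"
    using assms by (intro integrable_mult_indicator) (auto simp: L1_iff)
  then show ?thesis
    using assms by (simp add: L1_iff strongly_measurable_indicator)
qed

lemma set_integrable_L1:
  "A \<in> sets M \<Longrightarrow> f \<in> L1 M \<Longrightarrow> set_integrable M A (\<lambda>w. norm (f w))"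
  unfolding set_integrable_def by (intro integrable_mult_indicator) (auto simp: L1_iff)

lemma bochner_approx_integral_tendsto:
  assumes f: "f \<in> L1 M" and s: "bochner_approx M f s"
  shows "(\<lambda>i. \<integral>w. norm (f w - s i w) \<partial>M) \<longlonglongrightarrow> 0"
proof -
  have "(\<integral>\<^sup>+ w. ennreal (norm (f w - s i w)) \<partial>M) = ennreal (\<integral>w. norm (f w - s i w) \<partial>M)" for i
  proof (rule nn_integral_eq_integral)
    show "integrable M (\<lambda>w. norm (f w - s i w))"
      using L1_diff[OF f L1_simple, of "s i"] s
      by (simp add: L1_iff bochner_approx_def simple_bochner_integrable_iff)
  qed simp
  with s show ?thesis by (simp add: bochner_approx_def ennreal_tendsto_0_iff)
qed

lemma L1_simple_approx:
  assumes "f \<in> L1 M" "\<epsilon> > 0"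
  obtains s where "simple_function M s" "(\<integral>w. norm (f w - s w) \<partial>M) < \<epsilon>"
proof -
  obtain s where s: "bochner_approx M f s" using assms by (auto simp: L1_def)
  from order_tendstoD(2)[OF bochner_approx_integral_tendsto[OF assms(1) s] assms(2)]
  obtain i where "(\<integral>w. norm (f w - s i w) \<partial>M) < \<epsilon>" by (auto simp: eventually_sequentially)
  with s show thesis
    by (intro that[of "s i"]) (auto simp: bochner_approx_def simple_bochner_integrable_iff)
qed

section \<open>The strong integral and means, seen through continuous functionals\<close>

lemma integrable_pairing:
  fixes b :: "'a \<Rightarrow> ('b::real_normed_vector \<Rightarrow>\<^sub>L real)"
  assumes b: "strongly_measurable M b" "\<And>w. w \<in> space M \<Longrightarrow> norm (b w) \<le> C" and f: "f \<in> L1 M"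
  shows "integrable M (\<lambda>w. blinfun_apply (b w) (f w))"
proof (rule Bochner_Integration.integrable_bound)
  show "integrable M (\<lambda>w. C * norm (f w))" using f by (simp add: L1_iff)
  show "(\<lambda>w. blinfun_apply (b w) (f w)) \<in> borel_measurable M"
    using b f by (intro borel_measurable_pairing) (auto simp: L1_iff)
  have "norm (blinfun_apply (b w) (f w)) \<le> norm (C * norm (f w))" if "w \<in> space M" for w
    using norm_blinfun[of "b w" "f w"] mult_right_mono[OF b(2)[OF that] norm_ge_zero, of "f w"]
      abs_ge_self[of "C * norm (f w)"] unfolding real_norm_def by linarith
  then show "AE w in M. norm (blinfun_apply (b w) (f w)) \<le> norm (C * norm (f w))"
    by (rule AE_I2)
qed

lemma integrable_blinfun:
  fixes \<phi> :: "'b::real_normed_vector \<Rightarrow>\<^sub>L real"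
  shows
  "f \<in> L1 M \<Longrightarrow> integrable M (\<lambda>w. blinfun_apply \<phi> (f w))"
  using integrable_pairing[OF strongly_measurable_const order_refl] .

text \<open>For the simple approximants this is linearity, and replacing \<open>f\<close> by
  \<open>s i\<close> costs at most \<open>norm \<phi>\<close> times their L1 distance. Being stated
  for every candidate value \<open>x\<close>, it also yields the uniqueness that \<open>THE\<close>
  requires.\<close>

lemma has_strong_integral_blinfun:
  fixes \<phi> :: "'b::real_normed_vector \<Rightarrow>\<^sub>L real"
  assumes f: "f \<in> L1 M" and x: "has_strong_integral M f x"
  shows "blinfun_apply \<phi> x = (\<integral>w. blinfun_apply \<phi> (f w) \<partial>M)"
proof -
  obtain s where s: "bochner_approx M f s"
      and lim: "(\<lambda>i. Bochner_Integration.simple_bochner_integral M (s i)) \<longlonglongrightarrow> x"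
    using x by (auto simp: has_strong_integral_def)
  have si: "simple_function M (s i)" for i
    using s by (simp add: bochner_approx_def simple_bochner_integrable_iff)
  have eq: "blinfun_apply \<phi> (Bochner_Integration.simple_bochner_integral M (s i))
      = (\<integral>w. blinfun_apply \<phi> (s i w) \<partial>M)" for i
    using si[of i] simple_function_compose1[OF si[of i], of "blinfun_apply \<phi>"]
    by (simp add: simple_bochner_integrable_iff simple_bochner_integrable_eq_integral
      flip: simple_bochner_integral_linear[OF bounded_linear.linear[OF blinfun.bounded_linear_right]])
  have le: "\<bar>(\<integral>w. blinfun_apply \<phi> (s i w) \<partial>M) - (\<integral>w. blinfun_apply \<phi> (f w) \<partial>M)\<bar>
      \<le> norm \<phi> * (\<integral>w. norm (f w - s i w) \<partial>M)" for i
  proof -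
    have d: "(\<lambda>w. f w - s i w) \<in> L1 M" by (intro L1_diff f L1_simple si)
    have "\<bar>(\<integral>w. blinfun_apply \<phi> (s i w) \<partial>M) - (\<integral>w. blinfun_apply \<phi> (f w) \<partial>M)\<bar>
        = \<bar>\<integral>w. blinfun_apply \<phi> (f w - s i w) \<partial>M\<bar>"
      by (simp add: blinfun.diff_right integrable_blinfun f L1_simple si)
    also have "\<dots> \<le> (\<integral>w. norm \<phi> * norm (f w - s i w) \<partial>M)"
      by (rule order_trans[OF integral_abs_bound integral_mono])
        (use integrable_blinfun[OF d] d norm_blinfun[of \<phi>] in \<open>auto simp: L1_iff\<close>)
    finally show ?thesis by simp
  qed
  have lim0: "(\<lambda>i. norm \<phi> * (\<integral>w. norm (f w - s i w) \<partial>M)) \<longlonglongrightarrow> 0"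
    using tendsto_mult_left[OF bochner_approx_integral_tendsto[OF f s], of "norm \<phi>"] by simp
  have "(\<lambda>i. (\<integral>w. blinfun_apply \<phi> (s i w) \<partial>M) - (\<integral>w. blinfun_apply \<phi> (f w) \<partial>M)) \<longlonglongrightarrow> 0"
    by (rule Lim_null_comparison[OF always_eventually lim0]) (simp add: le)
  then have "(\<lambda>i. \<integral>w. blinfun_apply \<phi> (s i w) \<partial>M) \<longlonglongrightarrow> (\<integral>w. blinfun_apply \<phi> (f w) \<partial>M)"
    by (simp add: LIM_zero_iff)
  moreover have "(\<lambda>i. \<integral>w. blinfun_apply \<phi> (s i w) \<partial>M) \<longlonglongrightarrow> blinfun_apply \<phi> x"
    using blinfun.tendsto[OF tendsto_const lim, of \<phi>] by (simp add: eq)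
  ultimately show ?thesis by (metis LIMSEQ_unique)
qed

text \<open>Completeness of E enters here: the integrals of the approximants form a Cauchy sequence,
  as \<open>norm (I i - I j)\<close> is at most the sum of the two L1 errors.\<close>

lemma has_strong_integral_exists:
  fixes f :: "'a \<Rightarrow> 'b::banach"
  assumes f: "f \<in> L1 M"
  obtains x where "has_strong_integral M f x"
proof -
  obtain s where s: "bochner_approx M f s" using f by (auto simp: L1_def)
  have si: "simple_function M (s i)" for i
    using s by (simp add: bochner_approx_def simple_bochner_integrable_iff)
  define e where "e i = (\<integral>w. norm (f w - s i w) \<partial>M)" for i
  define I where "I i = Bochner_Integration.simple_bochner_integral M (s i)" for i
  have e: "e \<longlonglongrightarrow> 0" unfolding e_def by (rule bochner_approx_integral_tendsto[OF f s])
  have le: "norm (I i - I j) \<le> e i + e j" for i j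
  proof -
    have d: "simple_function M (\<lambda>w. s i w - s j w)" by (rule simple_function_compose2[OF si si])
    have int: "integrable M (\<lambda>w. norm (f w - s i w))" for i
      using L1_diff[OF f L1_simple[OF si]] by (simp add: L1_iff)
    have "norm (I i - I j)
        \<le> Bochner_Integration.simple_bochner_integral M (\<lambda>w. norm (s i w - s j w))"
      using simple_bochner_integral_norm_bound[of M "\<lambda>w. s i w - s j w"]
      by (simp add: I_def simple_bochner_integral_diff simple_bochner_integrable_iff si d)
    also have "\<dots> = (\<integral>w. norm (s i w - s j w) \<partial>M)"
      using simple_function_compose1[OF d, of norm]
      by (simp add: simple_bochner_integrable_eq_integral simple_bochner_integrable_iff)
    also have "\<dots> \<le> (\<integral>w. norm (f w - s i w) + norm (f w - s j w) \<partial>M)"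
    proof (rule integral_mono)
      show "norm (s i w - s j w) \<le> norm (f w - s i w) + norm (f w - s j w)" for w
        using norm_triangle_ineq4[of "f w - s j w" "f w - s i w"] by simp
    qed (use int integrable_norm_simple[OF d] in auto)
    also have "\<dots> = e i + e j" using int by (simp add: e_def)
    finally show ?thesis .
  qed
  have "Cauchy I"
  proof (rule metric_CauchyI)
    fix r :: real assume "r > 0"
    then have "\<forall>\<^sub>F i in sequentially. e i < r / 2" using order_tendstoD(2)[OF e, of "r / 2"] by simp
    then obtain N where N: "\<And>i. i \<ge> N \<Longrightarrow> e i < r / 2" by (auto simp: eventually_sequentially)
    have "dist (I m) (I n) < r" if "m \<ge> N" "n \<ge> N" for m n
      using le[of m n] N[OF that(1)] N[OF that(2)] by (simp add: dist_norm)
    then show "\<exists>N. \<forall>m\<ge>N. \<forall>n\<ge>N. dist (I m) (I n) < r" by blast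
  qed
  then obtain x where "I \<longlonglongrightarrow> x" using Cauchy_convergent convergent_def by blast
  with s f show thesis
    by (intro that[of x]) (auto simp: has_strong_integral_def L1_def I_def[abs_def])
qed

lemma strong_integral_blinfun:
  fixes f :: "'a \<Rightarrow> 'b::banach" and \<phi> :: "'b \<Rightarrow>\<^sub>L real"
  assumes f: "f \<in> L1 M"
  shows "blinfun_apply \<phi> (strong_integral M f) = (\<integral>w. blinfun_apply \<phi> (f w) \<partial>M)"
proof -
  obtain x where x: "has_strong_integral M f x" using has_strong_integral_exists[OF f] .
  have "strong_integral M f = x"
    unfolding strong_integral_def
  proof (rule the_equality[of "has_strong_integral M f", OF x])
    fix y assume "has_strong_integral M f y"
    then show "y = x"
      using has_strong_integral_blinfun[OF f] x by (metis blinfun_separate)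
  qed
  with x show ?thesis using has_strong_integral_blinfun[OF f] by blast
qed

lemma blinfun_mean_on:
  fixes f :: "'a \<Rightarrow> 'b::banach" and \<phi> :: "'b \<Rightarrow>\<^sub>L real"
  assumes "A \<in> sets M" "f \<in> L1 M"
  shows "blinfun_apply \<phi> (mean_on M A f) = (LINT w:A|M. blinfun_apply \<phi> (f w)) / measure M A"
  using strong_integral_blinfun[OF L1_indicator[OF assms], of \<phi>]
  by (simp add: mean_on_def blinfun.scaleR_right set_lebesgue_integral_def)

lemma mean_on_const:
  fixes x :: "'b::banach"
  assumes "A \<in> pos_sets M"
  shows "mean_on M A (\<lambda>_. x) = x"
proof (rule blinfun_separate)
  fix \<phi> :: "'b \<Rightarrow>\<^sub>L real"
  have "A \<in> sets M" "measure M A > 0" using assms by (auto simp: pos_sets_def)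
  then show "blinfun_apply \<phi> (mean_on M A (\<lambda>_. x)) = blinfun_apply \<phi> x"
    by (simp add: blinfun_mean_on L1_const set_lebesgue_integral_def)
qed

text \<open>A functional norming the difference of the two means turns the norm into a real
  integral, which is then estimated pointwise.\<close>

lemma norm_mean_on_diff_le:
  fixes f g :: "'a \<Rightarrow> 'b::banach"
  assumes A: "A \<in> pos_sets M" and f: "f \<in> L1 M" and g: "g \<in> L1 M"
  shows "norm (mean_on M A f - mean_on M A g) \<le> (LINT w:A|M. norm (f w - g w)) / measure M A"
proof -
  have A': "A \<in> sets M" "measure M A > 0" using A by (auto simp: pos_sets_def)
  obtain \<phi> :: "'b \<Rightarrow>\<^sub>L real" where \<phi>: "norm \<phi> \<le> 1"
    "blinfun_apply \<phi> (mean_on M A f - mean_on M A g) = norm (mean_on M A f - mean_on M A g)"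
    using norming_functional_exists .
  have si: "set_integrable M A (\<lambda>w. blinfun_apply \<phi> (h w))" if "h \<in> L1 M" for h
    unfolding set_integrable_def by (intro integrable_mult_indicator A' integrable_blinfun that)
  have "norm (mean_on M A f - mean_on M A g)
      = (LINT w:A|M. blinfun_apply \<phi> (f w - g w)) / measure M A"
    using \<phi>(2) by (simp add: blinfun.diff_right blinfun_mean_on A' f g si diff_divide_distrib)
  also have "\<dots> \<le> (LINT w:A|M. norm (f w - g w)) / measure M A"
  proof (intro divide_right_mono set_integral_mono si set_integrable_L1 L1_diff f g A')
    show "blinfun_apply \<phi> (f w - g w) \<le> norm (f w - g w)" for w
      using norm_blinfun[of \<phi> "f w - g w"] mult_right_mono[OF \<phi>(1), of "norm (f w - g w)"] by simp
  qed simp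
  finally show ?thesis .
qed

end

section \<open>Exhaustion along subsequences\<close>

text \<open>Replaces a maximum that may not be attained; in the exhaustion the tolerance tends to 0
  along the steps.\<close>

lemma approx_maximal_exists:
  fixes \<mu> :: "'x \<Rightarrow> real"
  assumes "\<exists>x. P x" "\<And>x. P x \<Longrightarrow> \<mu> x \<le> C" "\<epsilon> > 0"
  shows "\<exists>x. P x \<and> (\<forall>y. P y \<longrightarrow> \<mu> y < \<mu> x + \<epsilon>)"
proof -
  define S where "S = \<mu> ` Collect P"
  have ne: "S \<noteq> {}" and bdd: "bdd_above S"
    using assms by (auto simp: S_def intro!: bdd_aboveI2)
  have "Sup S - \<epsilon> < Sup S" using assms by simp
  then obtain x where x: "P x" "Sup S - \<epsilon> < \<mu> x"
    using less_cSup_iff[OF ne bdd, of "Sup S - \<epsilon>"] unfolding S_def by blast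
  have "\<mu> y < \<mu> x + \<epsilon>" if "P y" for y
  proof -
    have "\<mu> y \<le> Sup S" using that by (intro cSup_upper bdd) (auto simp: S_def)
    with x show ?thesis by simp
  qed
  with x show ?thesis by blast
qed

text \<open>The intersection of all \<open>S n\<close> may be empty. A strictly increasing diagonal
  choice of \<open>h n\<close> in \<open>S n\<close> works, since only terms \<open>h m\<close> with
  m < n can lie outside \<open>S n\<close>.\<close>

lemma infinite_pseudo_intersection:
  fixes S :: "nat \<Rightarrow> nat set"
  assumes dec: "\<And>n. S (Suc n) \<subseteq> S n" and inf: "\<And>n. infinite (S n)"
  obtains T where "infinite T" "\<And>n. finite (T - S n)"
proof -
  have ex: "\<exists>k\<in>S n. k > m" for m n using inf[of n] by (auto simp: infinite_nat_iff_unbounded)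
  have "\<exists>h. \<forall>n. h n \<in> S n \<and> h n < h (Suc n)"
  proof (rule dependent_nat_choice)
    show "\<exists>x. x \<in> S 0" using ex by blast
    show "\<exists>y. y \<in> S (Suc n) \<and> x < y" for x n using ex[of "Suc n" x] by blast
  qed
  then obtain h where h: "\<And>n. h n \<in> S n" "\<And>n. h n < h (Suc n)" by blast
  then have "strict_mono h" by (simp add: strict_mono_Suc_iff)
  then have "infinite (range h)" by (simp add: finite_image_iff strict_mono_imp_inj_on)
  moreover have "finite (range h - S n)" for n
  proof (rule finite_subset)
    have "h m \<in> S n" if "m \<ge> n" for m
      using h(1)[of m] lift_Suc_antimono_le[of S, OF dec that] by blast
    then have "m < n" if "h m \<notin> S n" for m using that not_le by blast
    then show "range h - S n \<subseteq> h ` {..<n}" by auto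
  qed simp
  ultimately show thesis by (rule that)
qed

context finite_measure
begin

text \<open>The states are pairs of a set and an infinite index set on which its bound holds. A
  state is extended by enlarging the set and thinning the indices, each time almost maximally in
  measure. A remainder of positive measure would contain a set C that could be adjoined at every
  stage, so almost maximality bounds its measure by a null sequence.\<close>

lemma exhaustion_subsequence:
  fixes u :: "nat \<Rightarrow> 'a \<Rightarrow> real"
  assumes int: "\<And>k. integrable M (u k)"
    and loc: "\<And>S B. infinite S \<Longrightarrow> B \<in> pos_sets M \<Longrightarrow>
      \<exists>A\<in>pos_subsets M B. infinite {k\<in>S. (LINT w:A|M. u k w) \<le> \<epsilon> * measure M A}"
    and S: "infinite S" and \<delta>: "\<delta> > 0"
  obtains A T where "A \<in> sets M" "T \<subseteq> S" "infinite T"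
    "\<And>k. k \<in> T \<Longrightarrow> (LINT w:A|M. u k w) \<le> \<epsilon> * measure M A" "measure M (space M - A) < \<delta>"
proof -
  define good where "good x \<longleftrightarrow> fst x \<in> sets M \<and> snd x \<subseteq> S \<and> infinite (snd x) \<and>
      (\<forall>k\<in>snd x. (LINT w:fst x|M. u k w) \<le> \<epsilon> * measure M (fst x))" for x :: "'a set \<times> nat set"
  define ext where "ext x y \<longleftrightarrow> fst x \<subseteq> fst y \<and> snd y \<subseteq> snd x" for x y :: "'a set \<times> nat set"
  have "\<exists>g. \<forall>n. good (g n) \<and> (ext (g n) (g (Suc n)) \<and> (\<forall>z. good z \<longrightarrow> ext (g n) z \<longrightarrow>
      measure M (fst z) < measure M (fst (g (Suc n))) + inverse (real (Suc n))))"
  proof (rule dependent_nat_choice)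
    have "good ({}, S)" using S by (simp add: good_def set_lebesgue_integral_def)
    then show "\<exists>x. good x" by blast
    fix x n assume "good x"
    then have "\<exists>y. good y \<and> ext x y" unfolding ext_def by blast
    moreover have "measure M (fst y) \<le> measure M (space M)" if "good y \<and> ext x y" for y
      by (rule bounded_measure)
    moreover have "inverse (real (Suc n)) > 0" by simp
    ultimately have "\<exists>y. (good y \<and> ext x y) \<and> (\<forall>z. good z \<and> ext x z \<longrightarrow>
        measure M (fst z) < measure M (fst y) + inverse (real (Suc n)))"
      by (rule approx_maximal_exists)
    then show "\<exists>y. good y \<and> (ext x y \<and> (\<forall>z. good z \<longrightarrow> ext x z \<longrightarrow>
        measure M (fst z) < measure M (fst y) + inverse (real (Suc n))))" by blast
  qed
  then obtain g where g: "\<And>n. good (g n)" and ext: "\<And>n. ext (g n) (g (Suc n))"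
    and max: "\<And>n z. good z \<Longrightarrow> ext (g n) z \<Longrightarrow>
      measure M (fst z) < measure M (fst (g (Suc n))) + inverse (real (Suc n))" by blast
  define A where "A n = fst (g n)" for n
  define R where "R n = snd (g n)" for n
  have A: "A n \<in> sets M" for n using g[of n] by (simp add: good_def A_def)
  have "incseq A" using ext by (intro incseq_SucI) (simp add: ext_def A_def)
  obtain T where T: "infinite T" "\<And>n. finite (T - R n)"
    by (rule infinite_pseudo_intersection[of R]) (use g ext in \<open>auto simp: good_def ext_def R_def\<close>)
  define B where "B = space M - (\<Union>n. A n)"
  have B: "B \<in> sets M" using A by (auto simp: B_def)
  have "measure M B = 0"
  proof (rule ccontr)
    assume "measure M B \<noteq> 0"
    then have "B \<in> pos_sets M" using B by (simp add: pos_sets_def zero_less_measure_iff)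
    \<comment> \<open>C has to be the same for all n. It is therefore obtained for \<open>T\<close>,
      and the finitely many indices of \<open>T\<close> outside \<open>R n\<close> are dropped
      afterwards.\<close>
    from loc[OF T(1) this] obtain C where C: "C \<in> sets M" "measure M C > 0" "C \<subseteq> B"
      and inf: "infinite {k\<in>T. (LINT w:C|M. u k w) \<le> \<epsilon> * measure M C}"
      by (auto simp: pos_subsets_def pos_sets_def)
    have bound: "measure M C < inverse (real (Suc n)) + (measure M (A (Suc n)) - measure M (A n))" for n
    proof -
      define Q where "Q = {k\<in>T \<inter> R n. (LINT w:C|M. u k w) \<le> \<epsilon> * measure M C}"
      have "{k\<in>T. (LINT w:C|M. u k w) \<le> \<epsilon> * measure M C} \<subseteq> Q \<union> (T - R n)" by (auto simp: Q_def)
      with inf T(2)[of n] have "infinite Q" by (meson finite_UnI finite_subset)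
      have disj: "A n \<inter> C = {}" using C by (auto simp: B_def)
      have "measure M (A n \<union> C) = measure M (A n) + measure M C"
        by (rule finite_measure_Union[OF A C(1) disj])
      moreover have "good (A n \<union> C, Q)"
        unfolding good_def fst_conv snd_conv
      proof (intro conjI ballI)
        show "Q \<subseteq> S" using g[of n] by (auto simp: Q_def R_def good_def)
        fix k assume k: "k \<in> Q"
        have si: "set_integrable M D (u k)" if "D \<in> sets M" for D
          unfolding set_integrable_def by (rule integrable_mult_indicator[OF that int])
        have "(LINT w:A n \<union> C|M. u k w) = (LINT w:A n|M. u k w) + (LINT w:C|M. u k w)"
          by (intro set_integral_Un disj si A C)
        also have "\<dots> \<le> \<epsilon> * measure M (A n) + \<epsilon> * measure M C"
          using k g[of n] by (intro add_mono) (auto simp: Q_def R_def A_def good_def)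
        finally show "(LINT w:A n \<union> C|M. u k w) \<le> \<epsilon> * measure M (A n \<union> C)"
          by (simp add: finite_measure_Union[OF A C(1) disj] distrib_left)
      qed (use A C \<open>infinite Q\<close> in auto)
      moreover have "ext (g n) (A n \<union> C, Q)" by (auto simp: ext_def A_def Q_def R_def)
      ultimately show ?thesis using max[of "(A n \<union> C, Q)" n] by (simp add: A_def)
    qed
    have "(\<lambda>n. measure M (A n)) \<longlonglongrightarrow> measure M (\<Union>n. A n)"
      using A \<open>incseq A\<close> by (intro finite_Lim_measure_incseq) auto
    then have "(\<lambda>n. inverse (real (Suc n)) + (measure M (A (Suc n)) - measure M (A n)))
        \<longlonglongrightarrow> 0 + (measure M (\<Union>n. A n) - measure M (\<Union>n. A n))"
      by (intro tendsto_intros LIMSEQ_inverse_real_of_nat LIMSEQ_Suc)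
    then have "measure M C \<le> 0"
      using bound by (intro LIMSEQ_le_const) (auto intro: less_imp_le)
    with C show False by simp
  qed
  have "(\<lambda>n. measure M (space M - A n)) \<longlonglongrightarrow> measure M (\<Inter>n. space M - A n)"
    using A \<open>incseq A\<close> by (intro finite_Lim_measure_decseq) (auto simp: decseq_def incseq_def)
  also have "(\<Inter>n. space M - A n) = B" by (auto simp: B_def)
  finally have "(\<lambda>n. measure M (space M - A n)) \<longlonglongrightarrow> 0" using \<open>measure M B = 0\<close> by simp
  from order_tendstoD(2)[OF this \<delta>] obtain n where "measure M (space M - A n) < \<delta>"
    by (auto simp: eventually_sequentially)
  \<comment> \<open>A finite stage is returned instead of the limit: the bound for
    \<open>A n\<close> holds at every index of \<open>R n\<close>, and the uncovered part is already
    smaller than \<open>\<delta>\<close>.\<close>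
  with g[of n] show thesis
    by (intro that[of "A n" "R n"]) (auto simp: good_def A_def R_def)
qed

text \<open>The exhaustion is run on the set of indices at which the integral stays at least
  \<open>\<eta>\<close>, so one surviving index gives the contradiction.\<close>

lemma integral_tendsto_zero_if_local:
  fixes u :: "nat \<Rightarrow> 'a \<Rightarrow> real"
  assumes int: "\<And>k. integrable M (u k)" and nonneg: "\<And>k w. 0 \<le> u k w"
    and ui: "\<And>\<epsilon>. \<epsilon> > 0 \<Longrightarrow> \<exists>\<delta>>0. \<exists>N. \<forall>k\<ge>N. \<forall>A\<in>sets M.
      measure M A < \<delta> \<longrightarrow> (LINT w:A|M. u k w) \<le> \<epsilon>"
    and loc: "\<And>S B \<epsilon>. infinite S \<Longrightarrow> B \<in> pos_sets M \<Longrightarrow> \<epsilon> > 0 \<Longrightarrow>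
      \<exists>A\<in>pos_subsets M B. infinite {k\<in>S. (LINT w:A|M. u k w) \<le> \<epsilon> * measure M A}"
  shows "(\<lambda>k. \<integral>w. u k w \<partial>M) \<longlonglongrightarrow> 0"
proof (rule ccontr)
  assume "\<not> ?thesis"
  then obtain \<eta> where "\<eta> > 0" and nev: "\<not> (\<forall>\<^sub>F k in sequentially. \<bar>\<integral>w. u k w \<partial>M\<bar> < \<eta>)"
    by (auto simp: tendsto_iff dist_real_def)
  define S where "S = {k. \<bar>\<integral>w. u k w \<partial>M\<bar> \<ge> \<eta>}"
  have "infinite S"
    using nev by (simp add: S_def frequently_cofinite[symmetric] cofinite_eq_sequentially
        not_eventually not_less)
  obtain \<delta> N where "\<delta> > 0" and N: "\<And>k A. k \<ge> N \<Longrightarrow> A \<in> sets M \<Longrightarrow> measure M A < \<delta> \<Longrightarrow>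
      (LINT w:A|M. u k w) \<le> \<eta> / 3"
    using ui[of "\<eta> / 3"] \<open>\<eta> > 0\<close> by auto
  define m where "m = measure M (space M)"
  \<comment> \<open>Chosen so that \<open>\<epsilon> * m \<le> \<eta> / 3\<close>; the summand 1
    keeps the denominator positive. Together with the remainder the total is at most two thirds of
    \<open>\<eta>\<close>.\<close>
  define \<epsilon> where "\<epsilon> = \<eta> / (3 * (m + 1))"
  have "m \<ge> 0" by (simp add: m_def)
  then have "\<epsilon> > 0" using \<open>\<eta> > 0\<close> by (simp add: \<epsilon>_def)
  \<comment> \<open>Discarding the indices below N makes the bound for small sets valid at every
    surviving index.\<close>
  have "infinite (S - {..<N})" using \<open>infinite S\<close> by simp
  from exhaustion_subsequence[OF int loc[OF _ _ \<open>\<epsilon> > 0\<close>] this \<open>\<delta> > 0\<close>]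
  obtain A T where A: "A \<in> sets M" and T: "T \<subseteq> S - {..<N}" "infinite T"
    "\<And>k. k \<in> T \<Longrightarrow> (LINT w:A|M. u k w) \<le> \<epsilon> * measure M A" "measure M (space M - A) < \<delta>" by metis
  from T(2) obtain k where k: "k \<in> T" by (auto dest: infinite_imp_nonempty)
  have si: "set_integrable M D (u k)" if "D \<in> sets M" for D
    unfolding set_integrable_def by (rule integrable_mult_indicator[OF that int])
  have "(\<integral>w. u k w \<partial>M) = (LINT w:A \<union> (space M - A)|M. u k w)"
    using sets.sets_into_space[OF A] by (simp add: Un_absorb1 set_integral_space int)
  also have "\<dots> = (LINT w:A|M. u k w) + (LINT w:space M - A|M. u k w)"
    by (intro set_integral_Un si) (use A in auto)
  also have "\<dots> \<le> \<epsilon> * m + \<eta> / 3"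
  proof (rule add_mono)
    have "\<epsilon> * measure M A \<le> \<epsilon> * m"
      using \<open>\<epsilon> > 0\<close> by (intro mult_left_mono) (auto simp: m_def bounded_measure)
    with T(3)[OF k] show "(LINT w:A|M. u k w) \<le> \<epsilon> * m" by simp
    show "(LINT w:space M - A|M. u k w) \<le> \<eta> / 3"
      using k T A by (intro N) auto
  qed
  also have "\<epsilon> * m \<le> \<eta> / 3"
    using \<open>\<eta> > 0\<close> \<open>m \<ge> 0\<close> by (simp add: \<epsilon>_def field_simps)
  finally have "(\<integral>w. u k w \<partial>M) < \<eta>" using \<open>\<eta> > 0\<close> by simp
  moreover have "(\<integral>w. u k w \<partial>M) \<ge> 0" by (simp add: nonneg)
  moreover have "k \<in> S" using k T by auto
  ultimately show False by (simp add: S_def)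
qed

end

section \<open>Uniform integrability\<close>

context finite_measure
begin

text \<open>A simple function within \<epsilon>/2 of \<open>f\<close> is bounded by some C, so the
  integral over A is at most \<epsilon>/2 plus C times the measure of A.\<close>

lemma L1_absolutely_continuous:
  assumes f: "f \<in> L1 M" and "\<epsilon> > 0"
  obtains \<delta> where "\<delta> > 0"
    "\<And>A. A \<in> sets M \<Longrightarrow> measure M A \<le> \<delta> \<Longrightarrow> (LINT w:A|M. norm (f w)) \<le> \<epsilon>"
proof -
  have "\<epsilon> / 2 > 0" using \<open>\<epsilon> > 0\<close> by simp
  from L1_simple_approx[OF f this] obtain s
    where s: "simple_function M s" and d: "(\<integral>w. norm (f w - s w) \<partial>M) < \<epsilon> / 2" .
  have "finite (norm ` s ` space M)" using s by (simp add: simple_function_def)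
  then obtain C where C: "\<And>w. w \<in> space M \<Longrightarrow> norm (s w) \<le> C" "C > 0"
    using bdd_above_finite[of "norm ` s ` space M"]
    by (auto simp: bdd_above_def) (metis less_le_not_le linorder_linear order_trans zero_less_one)
  have fs: "(\<lambda>w. f w - s w) \<in> L1 M" by (intro L1_diff f L1_simple s)
  show thesis
  proof (rule that[of "\<epsilon> / (2 * C)"])
    show "\<epsilon> / (2 * C) > 0" using \<open>\<epsilon> > 0\<close> \<open>C > 0\<close> by simp
    fix A assume A: "A \<in> sets M" and small: "measure M A \<le> \<epsilon> / (2 * C)"
    have intC: "integrable M (\<lambda>w. indicator A w * C)"
      by (intro integrable_mult_left integrable_real_indicator A) (simp add: less_top[symmetric])
    have "(LINT w:A|M. norm (f w)) \<le> (\<integral>w. norm (f w - s w) + indicator A w * C \<partial>M)"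
      unfolding set_lebesgue_integral_def
    proof (rule integral_mono)
      show "integrable M (\<lambda>w. indicator A w *\<^sub>R norm (f w))"
        using set_integrable_L1[OF A f] by (simp add: set_integrable_def)
      show "integrable M (\<lambda>w. norm (f w - s w) + indicator A w * C)"
        using fs intC by (auto simp: L1_iff)
      show "indicator A w *\<^sub>R norm (f w) \<le> norm (f w - s w) + indicator A w * C"
        if "w \<in> space M" for w
        using C(1)[OF that] norm_triangle_sub[of "f w" "s w"] by (auto simp: indicator_def)
    qed
    also have "\<dots> = (\<integral>w. norm (f w - s w) \<partial>M) + measure M A * C"
      using fs intC A by (simp add: L1_iff)
    also have "\<dots> \<le> \<epsilon> / 2 + \<epsilon> / (2 * C) * C"
      using d small \<open>C > 0\<close> by (intro add_mono mult_right_mono) auto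
    also have "\<dots> = \<epsilon>" using \<open>C > 0\<close> by simp
    finally show "(LINT w:A|M. norm (f w)) \<le> \<epsilon>" .
  qed
qed

text \<open>Norming functionals are attached to the values of a simple approximant. The choice
  \<open>J\<close> may be arbitrary, because its composition with a simple function is again
  simple.\<close>

lemma simple_norming_exists:
  fixes f :: "'a \<Rightarrow> 'b::real_normed_vector"
  assumes f: "f \<in> L1 M" and A: "A \<in> sets M" and "\<epsilon> > 0"
  obtains c :: "'a \<Rightarrow> 'b \<Rightarrow>\<^sub>L real" where "simple_function M c" "\<And>w. norm (c w) \<le> 1"
    "(LINT w:A|M. norm (f w)) - \<epsilon> \<le> (LINT w:A|M. blinfun_apply (c w) (f w))"
proof -
  have "\<epsilon> / 2 > 0" using \<open>\<epsilon> > 0\<close> by simp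
  from L1_simple_approx[OF f this] obtain s
    where s: "simple_function M s" and d: "(\<integral>w. norm (f w - s w) \<partial>M) < \<epsilon> / 2" .
  have "\<exists>J. \<forall>x::'b. norm (J x) \<le> 1 \<and> blinfun_apply (J x :: 'b \<Rightarrow>\<^sub>L real) x = norm x"
    by (rule choice) (metis norming_functional_exists)
  then obtain J :: "'b \<Rightarrow> 'b \<Rightarrow>\<^sub>L real"
    where J: "\<And>x. norm (J x) \<le> 1" "\<And>x. blinfun_apply (J x) x = norm x" by blast
  define c where "c w = J (s w)" for w
  have c: "simple_function M c" unfolding c_def[abs_def] by (rule simple_function_compose1[OF s])
  have c1: "norm (c w) \<le> 1" for w by (simp add: c_def J)
  have fs: "(\<lambda>w. f w - s w) \<in> L1 M" by (intro L1_diff f L1_simple s)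
  have cf: "integrable M (\<lambda>w. indicator A w *\<^sub>R blinfun_apply (c w) (f w))"
    by (intro integrable_mult_indicator A integrable_pairing[OF _ c1 f] strongly_measurable_simple c)
  have nf: "integrable M (\<lambda>w. indicator A w *\<^sub>R norm (f w))"
    using set_integrable_L1[OF A f] by (simp add: set_integrable_def)
  \<comment> \<open>The error \<open>norm (f w - s w)\<close> is paid twice: for passing from
    \<open>norm (f w)\<close> to \<open>norm (s w)\<close>, and for replacing \<open>s w\<close> by
    \<open>f w\<close> in the pairing. This is why \<open>s\<close> was taken within
    \<epsilon>/2.\<close>
  have pw: "indicator A w *\<^sub>R norm (f w)
      \<le> indicator A w *\<^sub>R blinfun_apply (c w) (f w) + 2 * norm (f w - s w)" for w
  proof -
    have "\<bar>blinfun_apply (c w) (f w - s w)\<bar> \<le> norm (f w - s w)"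
      using norm_blinfun[of "c w" "f w - s w"] mult_right_mono[OF c1[of w] norm_ge_zero[of "f w - s w"]]
      by simp
    moreover have "blinfun_apply (c w) (f w - s w) = blinfun_apply (c w) (f w) - norm (s w)"
      by (simp add: blinfun.diff_right c_def J)
    ultimately show ?thesis
      using norm_triangle_sub[of "f w" "s w"] by (auto simp: indicator_def)
  qed
  have "(LINT w:A|M. norm (f w))
      \<le> (\<integral>w. indicator A w *\<^sub>R blinfun_apply (c w) (f w) + 2 * norm (f w - s w) \<partial>M)"
    unfolding set_lebesgue_integral_def
    by (rule integral_mono[OF nf _ pw]) (use cf fs in \<open>auto simp: L1_iff\<close>)
  also have "\<dots> = (LINT w:A|M. blinfun_apply (c w) (f w)) + 2 * (\<integral>w. norm (f w - s w) \<partial>M)"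
    unfolding set_lebesgue_integral_def using cf fs by (simp add: L1_iff)
  finally show thesis using d by (intro that[OF c c1]) simp
qed

text \<open>The integrands agree off U, and on U each is at most \<open>norm (f w)\<close>. One
  multiplier will be a stage of the gliding hump, the other its pointwise limit.\<close>

lemma unit_multiplier_perturbation:
  fixes f :: "'a \<Rightarrow> 'b::real_normed_vector" and b b' :: "'a \<Rightarrow> 'b \<Rightarrow>\<^sub>L real"
  assumes f: "f \<in> L1 M" and U: "U \<in> sets M"
    and b: "strongly_measurable M b" "\<And>w. norm (b w) \<le> 1"
    and b': "strongly_measurable M b'" "\<And>w. norm (b' w) \<le> 1"
    and eq: "\<And>w. w \<in> space M - U \<Longrightarrow> b w = b' w"
  shows "\<bar>(\<integral>w. blinfun_apply (b w) (f w) \<partial>M) - (\<integral>w. blinfun_apply (b' w) (f w) \<partial>M)\<bar>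
    \<le> 2 * (LINT w:U|M. norm (f w))"
proof -
  have int: "integrable M (\<lambda>w. blinfun_apply (b w) (f w))" "integrable M (\<lambda>w. blinfun_apply (b' w) (f w))"
    using integrable_pairing[OF b f] integrable_pairing[OF b' f] by auto
  then have "\<bar>(\<integral>w. blinfun_apply (b w) (f w) \<partial>M) - (\<integral>w. blinfun_apply (b' w) (f w) \<partial>M)\<bar>
      = \<bar>\<integral>w. blinfun_apply (b w) (f w) - blinfun_apply (b' w) (f w) \<partial>M\<bar>" by simp
  also have "\<dots> \<le> (\<integral>w. \<bar>blinfun_apply (b w) (f w) - blinfun_apply (b' w) (f w)\<bar> \<partial>M)"
    by (rule integral_abs_bound)
  also have "\<dots> \<le> (\<integral>w. 2 * (indicator U w *\<^sub>R norm (f w)) \<partial>M)"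
  proof (rule integral_mono)
    show "integrable M (\<lambda>w. 2 * (indicator U w *\<^sub>R norm (f w)))"
      using set_integrable_L1[OF U f] by (simp add: set_integrable_def)
    show "\<bar>blinfun_apply (b w) (f w) - blinfun_apply (b' w) (f w)\<bar>
        \<le> 2 * (indicator U w *\<^sub>R norm (f w))" if "w \<in> space M" for w
    proof (cases "w \<in> U")
      case True
      have "\<bar>blinfun_apply \<phi> (f w)\<bar> \<le> norm (f w)" if "norm \<phi> \<le> 1" for \<phi> :: "'b \<Rightarrow>\<^sub>L real"
        using norm_blinfun[of \<phi> "f w"] mult_right_mono[OF that norm_ge_zero[of "f w"]] by simp
      from this[OF b(2)[of w]] this[OF b'(2)[of w]] True show ?thesis by simp
    qed (use eq that in auto)
  qed (use int in auto)
  finally show ?thesis by (simp add: set_lebesgue_integral_def)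
qed

text \<open>Gliding hump in the spirit of Vitali--Hahn--Saks: if uniform integrability fails, simple
  multipliers \<open>b\<^sub>0, b\<^sub>1, \<dots>\<close> can be modified on ever smaller sets so that \<open>g\<^bsub>k n\<^esub>\<close> keeps seeing a
  jump of at least \<open>\<epsilon>/4\<close>, and the pointwise limit of the multipliers is a forbidden test function.\<close>

lemma uniformly_integrable_if_sigma_null:
  fixes g :: "nat \<Rightarrow> 'a \<Rightarrow> 'b::real_normed_vector"
  assumes g: "\<And>k. g k \<in> L1 M"
    and null: "\<And>b. b \<in> Linf_dual M \<Longrightarrow> (\<lambda>k. \<integral>w. blinfun_apply (b w) (g k w) \<partial>M) \<longlonglongrightarrow> 0"
    and "\<epsilon> > 0"
  shows "\<exists>\<delta>>0. \<exists>N. \<forall>k\<ge>N. \<forall>A\<in>sets M. measure M A < \<delta> \<longrightarrow> (LINT w:A|M. norm (g k w)) \<le> \<epsilon>"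
proof (rule ccontr)
  assume "\<not> ?thesis"
  then have fail: "\<exists>k\<ge>N. \<exists>A\<in>sets M. measure M A < \<delta> \<and> (LINT w:A|M. norm (g k w)) > \<epsilon>"
    if "\<delta> > 0" for \<delta> N using that by (meson not_le)
  define T where "T k b = (\<integral>w. blinfun_apply (b w) (g k w) \<partial>M)" for k and b :: "'a \<Rightarrow> 'b \<Rightarrow>\<^sub>L real"
  define unit where "unit b \<longleftrightarrow> simple_function M b \<and> (\<forall>w. norm (b w) \<le> 1)"
    for b :: "'a \<Rightarrow> 'b \<Rightarrow>\<^sub>L real"
  \<comment> \<open>In a state (k, b, d), d is the measure budget for the next modification. As
    budgets halve, all later modifications live on a set of measure at most 2d, so they change
    \<open>T k b\<close> by at most 2 * \<epsilon>/16 = \<epsilon>/8, and at least \<epsilon>/8 of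
    the value survives.\<close>
  define P where "P = (\<lambda>(k :: nat, b :: 'a \<Rightarrow> 'b \<Rightarrow>\<^sub>L real, d :: real). unit b \<and> \<bar>T k b\<bar> > \<epsilon> / 4 \<and> d > 0 \<and>
    (\<forall>A\<in>sets M. measure M A \<le> 2 * d \<longrightarrow> (LINT w:A|M. norm (g k w)) \<le> \<epsilon> / 16))"
  define Q where "Q = (\<lambda>(k :: nat, b :: 'a \<Rightarrow> 'b \<Rightarrow>\<^sub>L real, d :: real) (k', b', d'). k < k' \<and> d' \<le> d / 2 \<and>
    (\<exists>A\<in>sets M. measure M A \<le> d \<and> (\<forall>w\<in>space M - A. b' w = b w)))"
  have step: "\<exists>y. P y \<and> Q (k, b, d) y" if b: "unit b" and "d > 0" for k b d
  proof -
    obtain k' A where k': "k' \<ge> Suc k" and A: "A \<in> sets M" "measure M A < d"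
      "(LINT w:A|M. norm (g k' w)) > \<epsilon>"
      using fail[OF \<open>d > 0\<close>, of "Suc k"] by blast
    obtain c :: "'a \<Rightarrow> 'b \<Rightarrow>\<^sub>L real" where c: "simple_function M c" "\<And>w. norm (c w) \<le> 1"
      "(LINT w:A|M. norm (g k' w)) - \<epsilon> / 2 \<le> (LINT w:A|M. blinfun_apply (c w) (g k' w))"
      using simple_norming_exists[OF g A(1), of "\<epsilon> / 2" k'] \<open>\<epsilon> > 0\<close> by auto
    \<comment> \<open>Nothing is known about the old multiplier on A. But \<open>b1\<close> and
      \<open>b2\<close> differ only there, and their values under \<open>T k'\<close> differ by more
      than \<epsilon>/2, so one of them exceeds \<epsilon>/4 in absolute value.\<close>
    define b1 where "b1 w = (if w \<in> A then c w else b w)" for w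
    define b2 where "b2 w = (if w \<in> A then 0 else b w)" for w
    have As: "A \<inter> space M \<in> sets M" using A by auto
    have u: "unit b1" "unit b2"
      using b c unfolding unit_def b1_def b2_def
      by (auto intro!: simple_function_If_set As)
    have "T k' b1 - T k' b2 = (LINT w:A|M. blinfun_apply (c w) (g k' w))"
    proof -
      have "integrable M (\<lambda>w. blinfun_apply (b w) (g k' w))" if "unit b" for b
        using that by (intro integrable_pairing[OF _ _ g, of _ 1] strongly_measurable_simple)
          (auto simp: unit_def)
      then have "T k' b1 - T k' b2 =
          (\<integral>w. blinfun_apply (b1 w) (g k' w) - blinfun_apply (b2 w) (g k' w) \<partial>M)"
        using u by (simp add: T_def)
      also have "\<dots> = (LINT w:A|M. blinfun_apply (c w) (g k' w))"
        unfolding set_lebesgue_integral_def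
        by (rule arg_cong[where f = "lebesgue_integral M"])
          (auto simp: b1_def b2_def indicator_def fun_eq_iff)
      finally show ?thesis .
    qed
    then have "\<bar>T k' b1\<bar> > \<epsilon> / 4 \<or> \<bar>T k' b2\<bar> > \<epsilon> / 4" using c(3) A(3) by linarith
    then obtain b' where b': "unit b'" "\<bar>T k' b'\<bar> > \<epsilon> / 4" "\<And>w. w \<notin> A \<Longrightarrow> b' w = b w"
      using u by (force simp: b1_def b2_def)
    have "\<epsilon> / 16 > 0" using \<open>\<epsilon> > 0\<close> by simp
    from L1_absolutely_continuous[OF g this, of k'] obtain \<delta> where \<delta>: "\<delta> > 0"
      "\<And>A. A \<in> sets M \<Longrightarrow> measure M A \<le> \<delta> \<Longrightarrow> (LINT w:A|M. norm (g k' w)) \<le> \<epsilon> / 16" by blast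
    have "P (k', b', min (d / 2) (\<delta> / 2))" using b' \<delta> \<open>d > 0\<close> by (auto simp: P_def)
    moreover have "Q (k, b, d) (k', b', min (d / 2) (\<delta> / 2))"
      using k' A b'(3) by (auto simp: Q_def intro!: bexI[of _ A])
    ultimately show ?thesis by blast
  qed
  have "\<exists>h. \<forall>n. P (h n) \<and> Q (h n) (h (Suc n))"
  proof (rule dependent_nat_choice)
    show "\<exists>x. P x" using step[of "\<lambda>_. 0" 1 0] by (auto simp: unit_def)
    show "\<exists>y. P y \<and> Q x y" if "P x" for x
      using that step by (cases x) (auto simp: P_def)
  qed
  then obtain h where h: "\<And>n. P (h n)" "\<And>n. Q (h n) (h (Suc n))" by blast
  define k b d where "k n = fst (h n)" and "b n = fst (snd (h n))" and "d n = snd (snd (h n))" for n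
  have hn: "h n = (k n, b n, d n)" for n by (simp add: k_def b_def d_def)
  have b: "unit (b n)" and large: "\<bar>T (k n) (b n)\<bar> > \<epsilon> / 4" and d: "d n > 0"
    and small: "\<And>A. A \<in> sets M \<Longrightarrow> measure M A \<le> 2 * d n \<Longrightarrow>
      (LINT w:A|M. norm (g (k n) w)) \<le> \<epsilon> / 16" for n
    using h(1)[of n] by (auto simp: P_def hn)
  have kmono: "strict_mono k" and dd: "d (Suc n) \<le> d n / 2" for n
    using h(2) by (auto simp: Q_def hn strict_mono_Suc_iff)
  have "\<forall>n. \<exists>A\<in>sets M. measure M A \<le> d n \<and> (\<forall>w\<in>space M - A. b (Suc n) w = b n w)"
    using h(2) by (auto simp: Q_def hn)
  then obtain A where A: "\<And>n. A n \<in> sets M" "\<And>n. measure M (A n) \<le> d n"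
    "\<And>n w. w \<in> space M - A n \<Longrightarrow> b (Suc n) w = b n w" by metis
  \<comment> \<open>\<open>U n\<close> collects all modifications from stage n on: off it,
    \<open>b n\<close> is already final.\<close>
  define U where "U n = (\<Union>i. A (n + i))" for n
  have U: "U n \<in> sets M" for n using A by (auto simp: U_def)
  have Ud: "measure M (U n) \<le> 2 * d n" for n
  proof -
    have di: "d (n + i) \<le> d n * (1 / 2) ^ i" for i
    proof (induction i)
      case (Suc i)
      then show ?case using dd[of "n + i"] by simp
    qed simp
    have Ai: "measure M (A (n + i)) \<le> d n * (1 / 2) ^ i" for i using A(2) di by (rule order_trans)
    have geo: "(\<lambda>i. d n * (1 / 2) ^ i) sums (d n * 2)"
      using sums_mult[OF geometric_sums[of "1 / 2 :: real"], of "d n"] by simp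
    then have sm: "summable (\<lambda>i. measure M (A (n + i)))"
      by (intro summable_comparison_test'[OF sums_summable[OF geo], of 0]) (use Ai in auto)
    have "measure M (U n) \<le> (\<Sum>i. measure M (A (n + i)))"
      unfolding U_def using A sm by (intro finite_measure_subadditive_countably) auto
    also have "\<dots> \<le> (\<Sum>i. d n * (1 / 2) ^ i)"
      by (intro suminf_le Ai sm sums_summable[OF geo])
    finally show ?thesis using sums_unique[OF geo] by simp
  qed
  define Z where "Z = (\<Inter>n. U n)"
  have Z: "Z \<in> sets M" using U by (auto simp: Z_def)
  have stable: "b m w = b n w" if "w \<in> space M - U n" "m \<ge> n" for m n w
    using that(2)
  proof (induction m rule: dec_induct)
    case (step m)
    then have "w \<notin> A m" using that(1) unfolding U_def by (metis DiffD2 UN_I UNIV_I le_Suc_ex)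
    then show ?case using A(3)[of w m] step that by auto
  qed simp
  \<comment> \<open>On \<open>Z\<close> the multipliers may change infinitely often. The value 0
    there makes the corrected simple functions converge to \<open>c\<close> at every point; as
    \<open>Z\<close> lies in each \<open>U n\<close>, the perturbation estimate still covers
    it.\<close>
  define c where "c w = (if w \<in> space M - Z then lim (\<lambda>i. b i w) else 0)" for w
  have c_eq: "c w = b n w" if "w \<in> space M - U n" for w n
  proof -
    have "\<forall>\<^sub>F i in sequentially. b i w = b n w"
      using stable[OF that] by (rule eventually_sequentiallyI)
    then have "lim (\<lambda>i. b i w) = b n w" by (intro limI) (rule tendsto_eventually)
    then show ?thesis using that by (auto simp: c_def Z_def)
  qed
  have csm: "strongly_measurable M c"
  proof (rule strongly_measurableI[where s = "\<lambda>i w. if w \<in> Z then 0 else b i w"])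
    show "simple_function M (\<lambda>w. if w \<in> Z then 0 else b i w)" for i
      using b[of i] Z by (intro simple_function_If_set) (auto simp: unit_def)
    fix w assume w: "w \<in> space M"
    show "(\<lambda>i. if w \<in> Z then 0 else b i w) \<longlonglongrightarrow> c w"
    proof (cases "w \<in> Z")
      case False
      then obtain n where n: "w \<in> space M - U n" using w by (auto simp: Z_def)
      have "(if w \<in> Z then 0 else b i w) = c w" if "i \<ge> n" for i
        using stable[OF n that] c_eq[OF n] False by simp
      then have "\<forall>\<^sub>F i in sequentially. (if w \<in> Z then 0 else b i w) = c w"
        by (rule eventually_sequentiallyI)
      then show ?thesis by (rule tendsto_eventually)
    qed (simp add: c_def)
  qed
  have c1: "norm (c w) \<le> 1" for w
  proof (cases "w \<in> space M - Z")
    case True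
    then obtain n where n: "w \<in> space M - U n" by (auto simp: Z_def)
    with c_eq[OF n] b[of n] show ?thesis by (simp add: unit_def)
  qed (auto simp: c_def)
  have "c \<in> Linf_dual M"
    using csm c1 by (auto simp: Linf_dual_def intro!: boundedI[of _ 1])
  from null[OF this] have "(\<lambda>k. T k c) \<longlonglongrightarrow> 0" by (simp add: T_def)
  from LIMSEQ_subseq_LIMSEQ[OF this kmono] have "(\<lambda>n. \<bar>T (k n) c\<bar>) \<longlonglongrightarrow> 0"
    by (simp add: comp_def tendsto_rabs_zero)
  moreover have "\<epsilon> / 8 \<le> \<bar>T (k n) c\<bar>" for n
  proof -
    have "\<bar>T (k n) c - T (k n) (b n)\<bar> \<le> 2 * (LINT w:U n|M. norm (g (k n) w))"
      unfolding T_def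
      by (rule unit_multiplier_perturbation[OF g U csm c1])
        (use b[of n] c_eq in \<open>auto simp: unit_def strongly_measurable_simple\<close>)
    also have "\<dots> \<le> 2 * (\<epsilon> / 16)" using small[OF U Ud, of n] by simp
    finally show ?thesis using large[of n] by linarith
  qed
  ultimately have "\<epsilon> / 8 \<le> 0" by (intro LIMSEQ_le_const) auto
  with \<open>\<epsilon> > 0\<close> show False by simp
qed

end

section \<open>Weak topologies, means and oscillations\<close>

lemma compact_insert_limit_range:
  fixes x :: "nat \<Rightarrow> 'a::topological_space"
  assumes "x \<longlonglongrightarrow> l"
  shows "compact (insert l (range x))"
  unfolding compact_eq_Heine_Borel
proof (intro allI impI, elim conjE)
  fix C assume op: "\<forall>t\<in>C. open t" and cov: "insert l (range x) \<subseteq> \<Union>C"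
  then obtain G where G: "G \<in> C" "l \<in> G" by blast
  obtain N where N: "\<And>n. n \<ge> N \<Longrightarrow> x n \<in> G"
    using topological_tendstoD[OF assms, of G] op G by (auto simp: eventually_sequentially)
  have "\<forall>n. \<exists>H\<in>C. x n \<in> H" using cov by blast
  then obtain H where H: "\<And>n. H n \<in> C" "\<And>n. x n \<in> H n" by metis
  have "x n \<in> \<Union>(insert G (H ` {..<N}))" for n
    using N[of n] H(2)[of n] by (cases "n < N") auto
  with G H show "\<exists>C'\<subseteq>C. finite C' \<and> insert l (range x) \<subseteq> \<Union>C'"
    by (intro exI[of _ "insert G (H ` {..<N})"]) auto
qed

context finite_measure
begin

lemma strongly_convergent_imp_weakly_convergent:
  fixes f :: "nat \<Rightarrow> 'a \<Rightarrow> 'b::real_normed_vector"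
  assumes f: "\<And>k. f k \<in> L1 M" and f0: "f0 \<in> L1 M" and conv: "strongly_convergent M f f0"
  shows "weakly_convergent M f f0"
  unfolding weakly_convergent_def
proof
  fix \<phi> :: "('a \<Rightarrow> 'b) \<Rightarrow> real" assume \<phi>: "\<phi> \<in> L1_dual M"
  show "(\<lambda>k. \<phi> (f k)) \<longlonglongrightarrow> \<phi> f0"
  proof (rule tendstoI)
    fix \<epsilon> :: real assume "\<epsilon> > 0"
    then obtain \<delta> where "\<delta> > 0"
      and \<delta>: "\<And>g. g \<in> L1 M \<Longrightarrow> L1_norm M (\<lambda>w. g w - f0 w) < \<delta> \<Longrightarrow> \<bar>\<phi> g - \<phi> f0\<bar> < \<epsilon>"
      using \<phi> f0 unfolding L1_dual_def by blast
    from order_tendstoD(2)[OF conv[unfolded strongly_convergent_def] \<open>\<delta> > 0\<close>]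
    show "\<forall>\<^sub>F k in sequentially. dist (\<phi> (f k)) (\<phi> f0) < \<epsilon>"
      by eventually_elim (simp add: dist_real_def \<delta> f)
  qed
qed

lemma pairing_bound:
  fixes b :: "'a \<Rightarrow> 'b::real_normed_vector \<Rightarrow>\<^sub>L real"
  assumes b: "b \<in> Linf_dual M"
  obtains C where "C > 0" "\<And>f g. f \<in> L1 M \<Longrightarrow> g \<in> L1 M \<Longrightarrow>
    \<bar>(\<integral>w. blinfun_apply (b w) (f w) \<partial>M) - (\<integral>w. blinfun_apply (b w) (g w) \<partial>M)\<bar>
      \<le> C * L1_norm M (\<lambda>w. f w - g w)"
proof -
  have sm: "strongly_measurable M b" using b by (simp add: Linf_dual_def)
  obtain C where "C > 0" and C: "\<And>w. w \<in> space M \<Longrightarrow> norm (b w) \<le> C"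
    using b by (auto simp: Linf_dual_def bounded_pos)
  show thesis
  proof (rule that[OF \<open>C > 0\<close>])
    fix f g :: "'a \<Rightarrow> 'b" assume f: "f \<in> L1 M" and g: "g \<in> L1 M"
    note int = integrable_pairing[OF sm C]
    have "\<bar>(\<integral>w. blinfun_apply (b w) (f w) \<partial>M) - (\<integral>w. blinfun_apply (b w) (g w) \<partial>M)\<bar>
        = \<bar>\<integral>w. blinfun_apply (b w) (f w - g w) \<partial>M\<bar>"
      using int[OF _ f] int[OF _ g] by (simp add: blinfun.diff_right)
    also have "\<dots> \<le> (\<integral>w. \<bar>blinfun_apply (b w) (f w - g w)\<bar> \<partial>M)"
      by (rule integral_abs_bound)
    also have "\<dots> \<le> (\<integral>w. C * norm (f w - g w) \<partial>M)"
    proof (rule integral_mono)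
      show "integrable M (\<lambda>w. \<bar>blinfun_apply (b w) (f w - g w)\<bar>)"
        using int[OF _ L1_diff[OF f g]] by simp
      show "integrable M (\<lambda>w. C * norm (f w - g w))"
        using L1_diff[OF f g] by (simp add: L1_iff)
      show "\<bar>blinfun_apply (b w) (f w - g w)\<bar> \<le> C * norm (f w - g w)" if "w \<in> space M" for w
        using norm_blinfun[of "b w" "f w - g w"]
          mult_right_mono[OF C[OF that] norm_ge_zero[of "f w - g w"]] by simp
    qed
    finally show "\<bar>(\<integral>w. blinfun_apply (b w) (f w) \<partial>M) - (\<integral>w. blinfun_apply (b w) (g w) \<partial>M)\<bar>
        \<le> C * L1_norm M (\<lambda>w. f w - g w)" by (simp add: L1_norm_def)
  qed
qed

text \<open>This is what makes (1) imply (1'): \<open>L1_dual\<close> consists of all continuous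
  linear functionals, and each test function induces one of them.\<close>

lemma pairing_in_L1_dual:
  fixes b :: "'a \<Rightarrow> 'b::real_normed_vector \<Rightarrow>\<^sub>L real"
  assumes b: "b \<in> Linf_dual M"
  shows "(\<lambda>f. \<integral>w. blinfun_apply (b w) (f w) \<partial>M) \<in> L1_dual M"
proof -
  have sm: "strongly_measurable M b" using b by (simp add: Linf_dual_def)
  obtain K where K: "\<And>w. w \<in> space M \<Longrightarrow> norm (b w) \<le> K"
    using b by (auto simp: Linf_dual_def bounded_pos)
  obtain C where C: "C > 0" "\<And>f g. f \<in> L1 M \<Longrightarrow> g \<in> L1 M \<Longrightarrow>
    \<bar>(\<integral>w. blinfun_apply (b w) (f w) \<partial>M) - (\<integral>w. blinfun_apply (b w) (g w) \<partial>M)\<bar>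
      \<le> C * L1_norm M (\<lambda>w. f w - g w)"
    using pairing_bound[OF b] by blast
  have "\<exists>\<delta>>0. \<forall>g\<in>L1 M. L1_norm M (\<lambda>w. g w - f w) < \<delta> \<longrightarrow>
      \<bar>(\<integral>w. blinfun_apply (b w) (g w) \<partial>M) - (\<integral>w. blinfun_apply (b w) (f w) \<partial>M)\<bar> < \<epsilon>"
    if f: "f \<in> L1 M" and "\<epsilon> > 0" for f \<epsilon>
  proof (intro exI[of _ "\<epsilon> / C"] conjI ballI impI)
    show "\<epsilon> / C > 0" using C \<open>\<epsilon> > 0\<close> by simp
    fix g assume "g \<in> L1 M" "L1_norm M (\<lambda>w. g w - f w) < \<epsilon> / C"
    then show "\<bar>(\<integral>w. blinfun_apply (b w) (g w) \<partial>M) - (\<integral>w. blinfun_apply (b w) (f w) \<partial>M)\<bar> < \<epsilon>"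
      using C(2)[OF _ f, of g] \<open>C > 0\<close> by (simp add: field_simps)
  qed
  then show ?thesis
    using integrable_pairing[OF sm K] by (simp add: L1_dual_def blinfun.add_right blinfun.scaleR_right)
qed

text \<open>Eventual membership passes from subbasic sets to finite intersections and arbitrary
  unions, hence the induction over \<open>generate_topology_on\<close>.\<close>

lemma limitin_sigma_topology_iff:
  fixes f0 :: "'a \<Rightarrow> 'b::real_normed_vector"
  assumes f: "\<And>k. f k \<in> L1 M" and f0: "f0 \<in> L1 M"
  shows "limitin (sigma_topology M) f f0 sequentially \<longleftrightarrow>
    (\<forall>b\<in>Linf_dual M. (\<lambda>k. \<integral>w. blinfun_apply (b w) (f k w) \<partial>M) \<longlonglongrightarrow> (\<integral>w. blinfun_apply (b w) (f0 w) \<partial>M))"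
    (is "?L \<longleftrightarrow> ?R")
proof
  define \<S> where "\<S> = {{f \<in> L1 M. (\<integral>w. blinfun_apply (b w) (f w) \<partial>M) \<in> U} | b U.
    b \<in> (Linf_dual M :: ('a \<Rightarrow> 'b \<Rightarrow>\<^sub>L real) set) \<and> open U}"
  have sig: "sigma_topology M = topology_generated_by \<S>" by (simp add: sigma_topology_def \<S>_def)
  show ?R if lim: ?L
  proof (intro ballI topological_tendstoI)
    fix b U assume b: "b \<in> Linf_dual M" and U: "open U" "(\<integral>w. blinfun_apply (b w) (f0 w) \<partial>M) \<in> U"
    have "openin (sigma_topology M) {f \<in> L1 M. (\<integral>w. blinfun_apply (b w) (f w) \<partial>M) \<in> U}"
      unfolding sig by (rule topology_generated_by_Basis) (use b U in \<open>auto simp: \<S>_def\<close>)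
    from limitinD[OF lim this] f0 U
    show "\<forall>\<^sub>F k in sequentially. (\<integral>w. blinfun_apply (b w) (f k w) \<partial>M) \<in> U"
      by (auto elim: eventually_mono)
  qed
  show ?L if R: ?R
    unfolding limitin_def
  proof (intro conjI allI impI)
    \<comment> \<open>The zero test function with \<open>U = UNIV\<close> exhibits
      \<open>L1 M\<close> as a subbasic set, so \<open>f0\<close> belongs to the topological
      space.\<close>
    have "(\<lambda>_. 0) \<in> (Linf_dual M :: ('a \<Rightarrow> 'b \<Rightarrow>\<^sub>L real) set)"
      by (auto simp: Linf_dual_def strongly_measurable_const intro!: boundedI[of _ 0])
    then have "L1 M \<in> \<S>" unfolding \<S>_def by (intro CollectI exI[of _ "\<lambda>_. 0"] exI[of _ UNIV]) auto
    then show "f0 \<in> topspace (sigma_topology M)"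
      using f0 by (auto simp: sig topology_generated_by_topspace)
    fix U assume U: "openin (sigma_topology M) U \<and> f0 \<in> U"
    then have "generate_topology_on \<S> U" by (simp add: sig openin_topology_generated_by_iff)
    then have "f0 \<in> U \<longrightarrow> (\<forall>\<^sub>F k in sequentially. f k \<in> U)"
    proof (induction rule: generate_topology_on.induct)
      case (UN K)
      then show ?case by (blast intro: eventually_mono)
    next
      case (Basis s)
      then obtain b V where b: "b \<in> Linf_dual M" and "open V"
        and s: "s = {f \<in> L1 M. (\<integral>w. blinfun_apply (b w) (f w) \<partial>M) \<in> V}"
        unfolding \<S>_def by blast
      show ?case
      proof
        assume "f0 \<in> s"
        with s have "(\<integral>w. blinfun_apply (b w) (f0 w) \<partial>M) \<in> V" by simp
        with R b \<open>open V\<close> have "\<forall>\<^sub>F k in sequentially. (\<integral>w. blinfun_apply (b w) (f k w) \<partial>M) \<in> V"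
          by (blast dest: topological_tendstoD)
        then show "\<forall>\<^sub>F k in sequentially. f k \<in> s" by eventually_elim (simp add: s f)
      qed
    qed (auto simp: eventually_conj)
    with U show "\<forall>\<^sub>F k in sequentially. f k \<in> U" by simp
  qed
qed

lemma weakly_convergent_imp_limitin_sigma:
  assumes "\<And>k. f k \<in> L1 M" "f0 \<in> L1 M" "weakly_convergent M f f0"
  shows "limitin (sigma_topology M) f f0 sequentially"
  unfolding limitin_sigma_topology_iff[OF assms(1,2)]
  using assms(3) pairing_in_L1_dual by (fastforce simp: weakly_convergent_def)

section \<open>Convergence and compactness of the means\<close>

lemma set_integral_norm_le_L1_norm:
  assumes "A \<in> sets M" "h \<in> L1 M"
  shows "(LINT w:A|M. norm (h w)) \<le> L1_norm M h"
  unfolding set_lebesgue_integral_def L1_norm_def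
  by (rule integral_mono)
    (use assms set_integrable_L1[OF assms] in \<open>auto simp: set_integrable_def L1_iff indicator_def\<close>)

lemma strongly_convergent_imp_means_convergent:
  fixes f :: "nat \<Rightarrow> 'a \<Rightarrow> 'b::banach"
  assumes f: "\<And>k. f k \<in> L1 M" and f0: "f0 \<in> L1 M" and conv: "strongly_convergent M f f0"
  shows "means_convergent M f f0"
  unfolding means_convergent_def
proof
  fix B assume B: "B \<in> pos_sets M"
  then have B': "B \<in> sets M" "measure M B > 0" by (auto simp: pos_sets_def)
  have le: "norm (mean_on M B (f k) - mean_on M B f0) \<le> L1_norm M (\<lambda>w. f k w - f0 w) / measure M B" for k
    using norm_mean_on_diff_le[OF B f f0, of k]
      set_integral_norm_le_L1_norm[OF B'(1) L1_diff[OF f f0], of k] B'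
    by (meson divide_right_mono less_imp_le order_trans)
  have "(\<lambda>k. L1_norm M (\<lambda>w. f k w - f0 w) / measure M B) \<longlonglongrightarrow> 0"
    using tendsto_divide[OF conv[unfolded strongly_convergent_def] tendsto_const] B' by fastforce
  then show "(\<lambda>k. norm (mean_on M B (f k) - mean_on M B f0)) \<longlonglongrightarrow> 0"
    by (rule Lim_null_comparison[rotated]) (simp add: le)
qed

lemma means_convergent_imp_relatively_compact:
  assumes "means_convergent M f f0"
  shows "means_relatively_compact M f"
  unfolding means_relatively_compact_def
proof
  fix B assume "B \<in> pos_sets M"
  with assms have "(\<lambda>k. mean_on M B (f k)) \<longlonglongrightarrow> mean_on M B f0"
    by (simp add: means_convergent_def LIM_zero_iff tendsto_norm_zero_iff)
  note K = compact_insert_limit_range[OF this]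
  have "closure (range (\<lambda>k. mean_on M B (f k))) \<subseteq> insert (mean_on M B f0) (range (\<lambda>k. mean_on M B (f k)))"
    by (rule closure_minimal) (auto intro: compact_imp_closed[OF K])
  then show "compact (closure (range (\<lambda>k. mean_on M B (f k))))"
    using compact_Int_closed[OF K closed_closure, of "range (\<lambda>k. mean_on M B (f k))"]
    by (simp add: Int_absorb1)
qed

text \<open>Testing with a constant functional times the indicator of B shows that the means
  converge weakly in E, so \<open>l\<close> is the only possible cluster point. Compactness gives a
  cluster point to any subsequence that stays away from \<open>l\<close>.\<close>

lemma relatively_compact_imp_means_convergent:
  fixes f :: "nat \<Rightarrow> 'a \<Rightarrow> 'b::banach"
  assumes f: "\<And>k. f k \<in> L1 M" and f0: "f0 \<in> L1 M"
    and lim: "limitin (sigma_topology M) f f0 sequentially" and rc: "means_relatively_compact M f"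
  shows "means_convergent M f f0"
  unfolding means_convergent_def
proof
  fix B assume B: "B \<in> pos_sets M"
  then have B': "B \<in> sets M" by (simp add: pos_sets_def)
  define x where "x k = mean_on M B (f k)" for k
  define l where "l = mean_on M B f0"
  have weak: "(\<lambda>k. blinfun_apply \<phi> (x k)) \<longlonglongrightarrow> blinfun_apply \<phi> l" for \<phi> :: "'b \<Rightarrow>\<^sub>L real"
  proof -
    have "(\<lambda>w. indicator B w *\<^sub>R \<phi>) \<in> Linf_dual M"
      unfolding Linf_dual_def
      by (intro CollectI conjI strongly_measurable_indicator[OF B' strongly_measurable_const]
          boundedI[of _ "norm \<phi>"]) (auto simp: indicator_def)
    then have "(\<lambda>k. LINT w:B|M. blinfun_apply \<phi> (f k w)) \<longlonglongrightarrow> (LINT w:B|M. blinfun_apply \<phi> (f0 w))"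
      using lim unfolding limitin_sigma_topology_iff[OF f f0]
      by (force simp: set_lebesgue_integral_def blinfun.scaleR_left)
    from tendsto_divide[OF this tendsto_const, of "measure M B"] B
    show ?thesis by (simp add: x_def l_def blinfun_mean_on B' f f0 pos_sets_def)
  qed
  have "x \<longlonglongrightarrow> l"
  proof (rule ccontr)
    assume "\<not> x \<longlonglongrightarrow> l"
    then obtain e where "e > 0" and ne: "\<not> (\<forall>\<^sub>F k in sequentially. dist (x k) l < e)"
      by (auto simp: tendsto_iff)
    from not_eventually_sequentiallyD[OF ne]
    obtain r :: "nat \<Rightarrow> nat" where r: "strict_mono r" "\<And>n. \<not> dist (x (r n)) l < e" by blast
    have "compact (closure (range x))"
      using rc B by (simp add: means_relatively_compact_def x_def[abs_def])
    moreover have "\<forall>n. (x \<circ> r) n \<in> closure (range x)" using closure_subset by fastforce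
    ultimately obtain y and s :: "nat \<Rightarrow> nat"
      where s: "strict_mono s" "((x \<circ> r) \<circ> s) \<longlonglongrightarrow> y"
      unfolding compact_def by blast
    have "blinfun_apply \<phi> y = blinfun_apply \<phi> l" for \<phi> :: "'b \<Rightarrow>\<^sub>L real"
    proof (rule LIMSEQ_unique)
      show "(\<lambda>n. blinfun_apply \<phi> (((x \<circ> r) \<circ> s) n)) \<longlonglongrightarrow> blinfun_apply \<phi> y"
        by (intro blinfun.tendsto tendsto_const s)
      show "(\<lambda>n. blinfun_apply \<phi> (((x \<circ> r) \<circ> s) n)) \<longlonglongrightarrow> blinfun_apply \<phi> l"
        using LIMSEQ_subseq_LIMSEQ[OF weak strict_mono_o[OF r(1) s(1)]] by (simp add: comp_def)
    qed
    then have "y = l" by (rule blinfun_separate)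
    then have "\<forall>\<^sub>F n in sequentially. dist (x (r (s n))) l < e"
      using s(2) \<open>e > 0\<close> by (simp add: tendsto_iff)
    with r(2) show False by simp
  qed
  then show "(\<lambda>k. norm (mean_on M B (f k) - mean_on M B f0)) \<longlonglongrightarrow> 0"
    by (simp add: x_def[abs_def] l_def LIM_zero_iff tendsto_norm_zero_iff)
qed

text \<open>A strongly measurable function is essentially separably valued.\<close>

lemma nearly_constant_subset_exists:
  fixes f :: "'a \<Rightarrow> 'b::real_normed_vector"
  assumes sm: "strongly_measurable M f" and B: "B \<in> pos_sets M" and "\<epsilon> > 0"
  obtains A x where "A \<in> pos_subsets M B" "\<And>w. w \<in> A \<Longrightarrow> norm (f w - x) < \<epsilon>"
proof -
  have B': "B \<in> sets M" "measure M B > 0" using B by (auto simp: pos_sets_def)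
  obtain s where s: "\<And>i. simple_function M (s i)" "\<And>w. w \<in> space M \<Longrightarrow> (\<lambda>i. s i w) \<longlonglongrightarrow> f w"
    using sm by (auto simp: strongly_measurable_def)
  \<comment> \<open>The values of all approximants form a countable set, and the \<epsilon>-balls
    around them contain every \<open>f w\<close>. So B is a countable union of the sets
    \<open>E x\<close>, and not all of these can be null.\<close>
  define D where "D = (\<Union>i. s i ` space M)"
  define E where "E x = {w \<in> B. norm (f w - x) < \<epsilon>}" for x
  have "countable D" using s(1) by (auto simp: D_def simple_function_def countable_finite)
  have E: "E x \<in> sets M" for x
  proof -
    have [measurable]: "(\<lambda>w. norm (f w - x)) \<in> borel_measurable M"
      by (intro borel_measurable_norm_strong strongly_measurable_diff sm strongly_measurable_const)
    have "E x = B \<inter> {w \<in> space M. norm (f w - x) < \<epsilon>}"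
      using sets.sets_into_space[OF B'(1)] by (auto simp: E_def)
    then show ?thesis using B' by simp
  qed
  have cover: "B \<subseteq> (\<Union>x\<in>D. E x)"
  proof
    fix w assume w: "w \<in> B"
    then have ws: "w \<in> space M" using sets.sets_into_space[OF B'(1)] by auto
    from tendstoD[OF s(2)[OF ws] \<open>\<epsilon> > 0\<close>] obtain i where "dist (s i w) (f w) < \<epsilon>"
      by (auto simp: eventually_sequentially)
    then show "w \<in> (\<Union>x\<in>D. E x)"
      using w ws by (auto simp: D_def E_def dist_norm norm_minus_commute)
  qed
  have "\<exists>x\<in>D. measure M (E x) > 0"
  proof (rule ccontr)
    assume "\<not> ?thesis"
    then have "E x \<in> null_sets M" if "x \<in> D" for x
      using that E by (auto simp: null_sets_def emeasure_eq_measure zero_less_measure_iff)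
    then have "(\<Union>x\<in>D. E x) \<in> null_sets M" by (rule null_sets_UN'[OF \<open>countable D\<close>])
    then have "B \<in> null_sets M" using cover B' by (blast intro: null_sets_subset)
    with B' show False by (simp add: null_sets_def emeasure_eq_measure)
  qed
  then obtain x where "measure M (E x) > 0" by blast
  with E show thesis
    by (intro that[of "E x" x]) (auto simp: pos_subsets_def pos_sets_def E_def)
qed

lemma mean_deviation_le_if_nearly_constant:
  fixes f :: "'a \<Rightarrow> 'b::banach"
  assumes A: "A \<in> pos_sets M" and f: "f \<in> L1 M" and le: "\<And>w. w \<in> A \<Longrightarrow> norm (f w - x) \<le> \<epsilon>"
  shows "(LINT w:A|M. norm (f w - mean_on M A f)) \<le> 2 * \<epsilon> * measure M A"
proof -
  have A': "A \<in> sets M" "measure M A > 0" using A by (auto simp: pos_sets_def)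
  have cint: "set_integrable M A (\<lambda>_. c)" for c :: real
    unfolding set_integrable_def using A'
    by (intro integrable_mult_indicator) auto
  have const: "(LINT w:A|M. c) = c * measure M A" for c :: real
    using A' by (simp add: set_lebesgue_integral_def)
  have "(LINT w:A|M. norm (f w - x)) \<le> (LINT w:A|M. \<epsilon>)"
    by (rule set_integral_mono[OF set_integrable_L1[OF A'(1) L1_diff[OF f L1_const]] cint le])
  with A' have "(LINT w:A|M. norm (f w - x)) / measure M A \<le> \<epsilon>"
    by (simp add: const field_simps)
  \<comment> \<open>The mean inherits the distance from \<open>x\<close>, as \<open>x\<close> is the
    mean of the constant function; the factor 2 is the detour from \<open>f w\<close> to the mean
    through \<open>x\<close>.\<close>
  then have m: "norm (mean_on M A f - x) \<le> \<epsilon>"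
    using norm_mean_on_diff_le[OF A f L1_const, of x] by (simp add: mean_on_const[OF A])
  have "(LINT w:A|M. norm (f w - mean_on M A f)) \<le> (LINT w:A|M. 2 * \<epsilon>)"
  proof (rule set_integral_mono[OF set_integrable_L1[OF A'(1) L1_diff[OF f L1_const]] cint])
    show "norm (f w - mean_on M A f) \<le> 2 * \<epsilon>" if "w \<in> A" for w
      using le[OF that] m norm_triangle_ineq4[of "f w - x" "mean_on M A f - x"] by simp
  qed
  then show ?thesis by (simp add: const mult_ac)
qed

text \<open>Both parts are triangle inequalities through the two means. The first bounds the
  oscillation of \<open>f\<close> by its distance from \<open>g\<close>, with factor 2 because the
  means differ by at most the averaged distance; it serves necessity. The second recovers the
  distance from oscillations and means, for sufficiency.\<close>

lemma mean_deviation_le: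
  fixes f g :: "'a \<Rightarrow> 'b::banach"
  assumes A: "A \<in> pos_sets M" and f: "f \<in> L1 M" and g: "g \<in> L1 M"
  shows "(LINT w:A|M. norm (f w - mean_on M A f)) \<le>
    2 * (LINT w:A|M. norm (f w - g w)) + (LINT w:A|M. norm (g w - mean_on M A g))"
    and "(LINT w:A|M. norm (f w - g w)) \<le> (LINT w:A|M. norm (f w - mean_on M A f)) +
      (LINT w:A|M. norm (g w - mean_on M A g)) + norm (mean_on M A f - mean_on M A g) * measure M A"
proof -
  have A': "A \<in> sets M" "measure M A > 0" using A by (auto simp: pos_sets_def)
  define c where "c = norm (mean_on M A f - mean_on M A g)"
  have cint: "set_integrable M A (\<lambda>_. c)"
    unfolding set_integrable_def using A' by (intro integrable_mult_indicator) auto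
  have const: "(LINT w:A|M. c) = c * measure M A"
    using A' by (simp add: set_lebesgue_integral_def)
  note int = set_integrable_L1[OF A'(1) L1_diff[OF f L1_const]]
    set_integrable_L1[OF A'(1) L1_diff[OF g L1_const]] set_integrable_L1[OF A'(1) L1_diff[OF f g]] cint
  have "(LINT w:A|M. norm (f w - mean_on M A f))
      \<le> (LINT w:A|M. norm (f w - g w) + norm (g w - mean_on M A g) + c)"
  proof (rule set_integral_mono)
    show "norm (f w - mean_on M A f) \<le> norm (f w - g w) + norm (g w - mean_on M A g) + c" for w
      using norm_triangle_ineq4[of "f w - g w + (g w - mean_on M A g)" "mean_on M A f - mean_on M A g"]
        norm_triangle_ineq[of "f w - g w" "g w - mean_on M A g"] by (simp add: c_def)
  qed (intro int set_integral_add)+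
  also have "\<dots> = (LINT w:A|M. norm (f w - g w)) + (LINT w:A|M. norm (g w - mean_on M A g)) + c * measure M A"
    by (simp add: int set_integral_add const)
  also have "c * measure M A \<le> (LINT w:A|M. norm (f w - g w))"
    using norm_mean_on_diff_le[OF A f g] A' by (simp add: c_def field_simps)
  finally show "(LINT w:A|M. norm (f w - mean_on M A f)) \<le>
    2 * (LINT w:A|M. norm (f w - g w)) + (LINT w:A|M. norm (g w - mean_on M A g))" by simp
  have "(LINT w:A|M. norm (f w - g w))
      \<le> (LINT w:A|M. norm (f w - mean_on M A f) + norm (g w - mean_on M A g) + c)"
  proof (rule set_integral_mono)
    show "norm (f w - g w) \<le> norm (f w - mean_on M A f) + norm (g w - mean_on M A g) + c" for w
      using norm_triangle_ineq[of "f w - mean_on M A f - (g w - mean_on M A g)" "mean_on M A f - mean_on M A g"]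
        norm_triangle_ineq4[of "f w - mean_on M A f" "g w - mean_on M A g"] by (simp add: c_def)
  qed (intro int set_integral_add)+
  also have "\<dots> = (LINT w:A|M. norm (f w - mean_on M A f)) +
      (LINT w:A|M. norm (g w - mean_on M A g)) + c * measure M A"
    by (simp add: int set_integral_add const)
  finally show "(LINT w:A|M. norm (f w - g w)) \<le> (LINT w:A|M. norm (f w - mean_on M A f)) +
      (LINT w:A|M. norm (g w - mean_on M A g)) + norm (mean_on M A f - mean_on M A g) * measure M A"
    by (simp add: c_def)
qed

text \<open>The set A is chosen from \<open>f0\<close> alone, and the subsequence inherits the small
  oscillation of \<open>f0\<close> there. The two contributions 2 * \<epsilon>/8 add up to
  \<epsilon>/2, leaving room for the strict inequality of the liminf.\<close>

lemma strongly_convergent_imp_seq_bocce: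
  fixes f :: "nat \<Rightarrow> 'a \<Rightarrow> 'b::banach"
  assumes f: "\<And>k. f k \<in> L1 M" and f0: "f0 \<in> L1 M" and conv: "strongly_convergent M f f0"
  shows "seq_bocce_criterion M f"
  unfolding seq_bocce_criterion_def
proof (intro allI impI ballI)
  fix r :: "nat \<Rightarrow> nat" and \<epsilon> :: real and B
  assume r: "strict_mono r" and "\<epsilon> > 0" and B: "B \<in> pos_sets M"
  have "strongly_measurable M f0" "\<epsilon> / 8 > 0" using f0 \<open>\<epsilon> > 0\<close> by (auto simp: L1_iff)
  from nearly_constant_subset_exists[OF this(1) B this(2)] obtain A x
    where A: "A \<in> pos_subsets M B" and x: "\<And>w. w \<in> A \<Longrightarrow> norm (f0 w - x) < \<epsilon> / 8" by blast
  have Ap: "A \<in> pos_sets M" and A': "A \<in> sets M" "measure M A > 0"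
    using A by (auto simp: pos_subsets_def pos_sets_def)
  have "(\<lambda>j. L1_norm M (\<lambda>w. f (r j) w - f0 w)) \<longlonglongrightarrow> 0"
    using LIMSEQ_subseq_LIMSEQ[OF conv[unfolded strongly_convergent_def] r] by (simp add: comp_def)
  moreover have "\<epsilon> / 8 * measure M A > 0" using \<open>\<epsilon> > 0\<close> A' by simp
  ultimately have "\<forall>\<^sub>F j in sequentially. L1_norm M (\<lambda>w. f (r j) w - f0 w) < \<epsilon> / 8 * measure M A"
    by (rule order_tendstoD(2))
  then have "\<forall>\<^sub>F j in sequentially. ereal (bocce_osc M A (f (r j))) \<le> ereal (\<epsilon> / 2)"
  proof eventually_elim
    case (elim j)
    have "(LINT w:A|M. norm (f (r j) w - mean_on M A (f (r j))))
        \<le> 2 * (\<epsilon> / 8 * measure M A) + 2 * (\<epsilon> / 8) * measure M A"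
      using mean_deviation_le(1)[OF Ap f f0, of "r j"] elim
        set_integral_norm_le_L1_norm[OF A'(1) L1_diff[OF f f0], of "r j"]
        mean_deviation_le_if_nearly_constant[OF Ap f0 less_imp_le[OF x]] by linarith
    then show ?case using A' by (simp add: bocce_osc_def field_simps)
  qed
  then have "liminf (\<lambda>j. ereal (bocce_osc M A (f (r j)))) \<le> liminf (\<lambda>j. ereal (\<epsilon> / 2))"
    by (rule Liminf_mono)
  also have "\<dots> < ereal \<epsilon>" using \<open>\<epsilon> > 0\<close> by (simp add: Liminf_const)
  finally show "\<exists>A\<in>pos_subsets M B. liminf (\<lambda>j. ereal (bocce_osc M A (f (r j)))) < ereal \<epsilon>"
    using A by blast
qed

text \<open>The criterion is applied inside a set on which \<open>f0\<close> is nearly constant: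
  whatever subset A it returns, the oscillation of \<open>f0\<close> on A is small. The
  contributions are \<epsilon>/4 from \<open>f k\<close>, 2 * \<epsilon>/8 from \<open>f0\<close>
  and \<epsilon>/4 from the means.\<close>

lemma seq_bocce_imp_local_smallness:
  fixes f :: "nat \<Rightarrow> 'a \<Rightarrow> 'b::banach"
  assumes f: "\<And>k. f k \<in> L1 M" and f0: "f0 \<in> L1 M"
    and bocce: "seq_bocce_criterion M f" and means: "means_convergent M f f0"
    and S: "infinite S" and B: "B \<in> pos_sets M" and "\<epsilon> > 0"
  shows "\<exists>A\<in>pos_subsets M B. infinite {k\<in>S. (LINT w:A|M. norm (f k w - f0 w)) \<le> \<epsilon> * measure M A}"
proof -
  have "strongly_measurable M f0" "\<epsilon> / 8 > 0" using f0 \<open>\<epsilon> > 0\<close> by (auto simp: L1_iff)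
  from nearly_constant_subset_exists[OF this(1) B this(2)] obtain B' x
    where B': "B' \<in> pos_subsets M B" and x: "\<And>w. w \<in> B' \<Longrightarrow> norm (f0 w - x) < \<epsilon> / 8" by blast
  \<comment> \<open>Enumerating S turns the quantifier over subsequences in the criterion into one
    over infinite index sets.\<close>
  define r where "r = enumerate S"
  have r: "strict_mono r" unfolding r_def by (rule strict_mono_enumerate[OF S])
  have "B' \<in> pos_sets M" "\<epsilon> / 4 > 0" using B' \<open>\<epsilon> > 0\<close> by (auto simp: pos_subsets_def)
  with bocce r obtain A where A: "A \<in> pos_subsets M B'"
    and liminf: "liminf (\<lambda>j. ereal (bocce_osc M A (f (r j)))) < ereal (\<epsilon> / 4)"
    unfolding seq_bocce_criterion_def by blast
  have Ap: "A \<in> pos_sets M" and A': "A \<in> sets M" "measure M A > 0" "A \<subseteq> B'"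
    using A by (auto simp: pos_subsets_def pos_sets_def)
  \<comment> \<open>A small liminf gives small oscillation only frequently. This can be combined
    with the bound on the means, which holds eventually.\<close>
  have freq: "\<exists>\<^sub>F j in sequentially. bocce_osc M A (f (r j)) < \<epsilon> / 4"
  proof (rule ccontr)
    assume "\<not> ?thesis"
    then have "\<forall>\<^sub>F j in sequentially. ereal (\<epsilon> / 4) \<le> ereal (bocce_osc M A (f (r j)))"
      by (simp add: not_frequently not_less)
    from Liminf_bounded[OF this] liminf show False by simp
  qed
  have "(\<lambda>k. norm (mean_on M A (f k) - mean_on M A f0)) \<longlonglongrightarrow> 0"
    using means Ap by (simp add: means_convergent_def)
  from LIMSEQ_subseq_LIMSEQ[OF this r]
  have "\<forall>\<^sub>F j in sequentially. norm (mean_on M A (f (r j)) - mean_on M A f0) < \<epsilon> / 4"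
    using order_tendstoD(2)[of _ 0 sequentially "\<epsilon> / 4"] \<open>\<epsilon> / 4 > 0\<close> by (simp add: comp_def)
  from frequently_eventually_conj[OF freq this]
  have "\<exists>\<^sub>F j in sequentially. (LINT w:A|M. norm (f (r j) w - f0 w)) \<le> \<epsilon> * measure M A"
  proof (rule frequently_mono[rotated]; intro allI impI; elim conjE)
    fix j assume m: "norm (mean_on M A (f (r j)) - mean_on M A f0) < \<epsilon> / 4"
      and o: "bocce_osc M A (f (r j)) < \<epsilon> / 4"
    have "(LINT w:A|M. norm (f (r j) w - f0 w)) \<le> \<epsilon> / 4 * measure M A
        + 2 * (\<epsilon> / 8) * measure M A + \<epsilon> / 4 * measure M A"
    proof (rule order_trans[OF mean_deviation_le(2)[OF Ap f f0]], intro add_mono)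
      show "(LINT w:A|M. norm (f (r j) w - mean_on M A (f (r j)))) \<le> \<epsilon> / 4 * measure M A"
        using o A' by (simp add: bocce_osc_def field_simps)
      show "(LINT w:A|M. norm (f0 w - mean_on M A f0)) \<le> 2 * (\<epsilon> / 8) * measure M A"
        using x A' by (intro mean_deviation_le_if_nearly_constant[OF Ap f0]) (auto intro: less_imp_le)
      show "norm (mean_on M A (f (r j)) - mean_on M A f0) * measure M A \<le> \<epsilon> / 4 * measure M A"
        using m A' by (intro mult_right_mono) auto
    qed
    also have "\<dots> \<le> \<epsilon> * measure M A" using \<open>\<epsilon> > 0\<close> by (simp add: field_simps)
    finally show "(LINT w:A|M. norm (f (r j) w - f0 w)) \<le> \<epsilon> * measure M A" .
  qed
  then have "infinite {j. (LINT w:A|M. norm (f (r j) w - f0 w)) \<le> \<epsilon> * measure M A}"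
    by (simp add: frequently_cofinite flip: cofinite_eq_sequentially)
  then have "infinite (r ` {j. (LINT w:A|M. norm (f (r j) w - f0 w)) \<le> \<epsilon> * measure M A})"
    using strict_mono_imp_inj_on[OF r] by (simp add: finite_image_iff inj_on_subset)
  moreover have "r ` {j. (LINT w:A|M. norm (f (r j) w - f0 w)) \<le> \<epsilon> * measure M A}
      \<subseteq> {k\<in>S. (LINT w:A|M. norm (f k w - f0 w)) \<le> \<epsilon> * measure M A}"
    using enumerate_in_set[OF S] by (auto simp: r_def)
  ultimately have "infinite {k\<in>S. (LINT w:A|M. norm (f k w - f0 w)) \<le> \<epsilon> * measure M A}"
    using finite_subset by blast
  moreover have "A \<in> pos_subsets M B" using A B' by (auto simp: pos_subsets_def)
  ultimately show ?thesis by blast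
qed

lemma sigma_bocce_means_imp_strongly_convergent:
  fixes f :: "nat \<Rightarrow> 'a \<Rightarrow> 'b::banach"
  assumes f: "\<And>k. f k \<in> L1 M" and f0: "f0 \<in> L1 M"
    and lim: "limitin (sigma_topology M) f f0 sequentially"
    and bocce: "seq_bocce_criterion M f" and means: "means_convergent M f f0"
  shows "strongly_convergent M f f0"
  unfolding strongly_convergent_def L1_norm_def
proof (rule integral_tendsto_zero_if_local)
  have h: "(\<lambda>w. f k w - f0 w) \<in> L1 M" for k by (rule L1_diff[OF f f0])
  then show "integrable M (\<lambda>w. norm (f k w - f0 w))" for k by (simp add: L1_iff)
  have null: "(\<lambda>k. \<integral>w. blinfun_apply (b w) (f k w - f0 w) \<partial>M) \<longlonglongrightarrow> 0" if b: "b \<in> Linf_dual M" for b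
  proof -
    have sm: "strongly_measurable M b" using b by (simp add: Linf_dual_def)
    obtain K where K: "\<And>w. w \<in> space M \<Longrightarrow> norm (b w) \<le> K"
      using b by (auto simp: Linf_dual_def bounded_pos)
    have "(\<integral>w. blinfun_apply (b w) (f k w - f0 w) \<partial>M)
        = (\<integral>w. blinfun_apply (b w) (f k w) \<partial>M) - (\<integral>w. blinfun_apply (b w) (f0 w) \<partial>M)" for k
      using integrable_pairing[OF sm K f] integrable_pairing[OF sm K f0]
      by (simp add: blinfun.diff_right)
    with lim b show ?thesis
      by (simp add: limitin_sigma_topology_iff[OF f f0] LIM_zero)
  qed
  show "\<exists>\<delta>>0. \<exists>N. \<forall>k\<ge>N. \<forall>A\<in>sets M. measure M A < \<delta> \<longrightarrow> (LINT w:A|M. norm (f k w - f0 w)) \<le> \<epsilon>"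
    if "\<epsilon> > 0" for \<epsilon>
    by (rule uniformly_integrable_if_sigma_null[OF h null that])
  show "\<exists>A\<in>pos_subsets M B. infinite {k\<in>S. (LINT w:A|M. norm (f k w - f0 w)) \<le> \<epsilon> * measure M A}"
    if "infinite S" "B \<in> pos_sets M" "\<epsilon> > 0" for S B \<epsilon>
    by (rule seq_bocce_imp_local_smallness[OF f f0 bocce means that])
qed simp

end

theorem theorem2p3:
  fixes M :: "'w measure"
    and f :: "nat \<Rightarrow> 'w \<Rightarrow> 'a::banach"
    and f0 :: "'w \<Rightarrow> 'a"
  assumes "prob_space M"
    and "\<And>k. f k \<in> L1 M"
    and "f0 \<in> L1 M"
  shows "(strongly_convergent M f f0 \<longleftrightarrow>
            weakly_convergent M f f0 \<and> seq_bocce_criterion M f \<and> means_relatively_compact M f) \<and>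
         (strongly_convergent M f f0 \<longleftrightarrow>
            limitin (sigma_topology M) f f0 sequentially \<and> seq_bocce_criterion M f \<and> means_relatively_compact M f) \<and>
         (strongly_convergent M f f0 \<longleftrightarrow>
            weakly_convergent M f f0 \<and> seq_bocce_criterion M f \<and> means_convergent M f f0) \<and>
         (strongly_convergent M f f0 \<longleftrightarrow>
            limitin (sigma_topology M) f f0 sequentially \<and> seq_bocce_criterion M f \<and> means_convergent M f f0)"
proof -
  interpret prob_space M by fact
  note f = assms(2,3)
  note strong = strongly_convergent_imp_weakly_convergent[of f f0, OF f] strongly_convergent_imp_means_convergent[of f f0, OF f]
    strongly_convergent_imp_seq_bocce[of f f0, OF f]
  \<comment> \<open>All four equivalences share one cycle: strong convergence gives (1), (2), (3');
    (1) gives (1'), (3') gives (3), and (3) with (1') gives (3') back. Sufficiency thus always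
    reduces to (1'), (2), (3').\<close>
  show ?thesis
    using strong weakly_convergent_imp_limitin_sigma[of f f0, OF f]
      means_convergent_imp_relatively_compact[of f f0]
      relatively_compact_imp_means_convergent[of f f0, OF f] sigma_bocce_means_imp_strongly_convergent[of f f0, OF f]
    by blast
qed

end
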